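(* Let $M=\{[a_1,b_1],\ldots,[a_k,b_k]\}$ be a rank set with $b_1<\cdots<b_k\le n$. Then the rank variety $\Sigma_M\subseteq\operatorname{Gr}(k,n)$ equals the positroid variety $\Pi_{f_M}$.
   Context: A rank set is a finite set of intervals $[a_i,b_i]=\{a_i,\ldots,b_i\}$ of positive integers with $a_i\le b_i$, all $a_i$ distinct and all $b_i$ distinct. For a set $S$ of positive integers, $S(M)$ is the set of intervals of $M$ contained in $S$. Fix a basis $e_1,\ldots,e_n$ of $\mathbb{C}^n$; for $X\subseteq[n]$, $\langle X\rangle$ is the span of $\{e_i:i\in X\}$. The rank variety $\Sigma_M$ is the closure in $\operatorname{Gr}(k,n)$ of $\{V : \dim(V\cap\langle S\cap T\rangle)=\#(S\cap T)(M) \text{ for all } S,T\in M\}$. An affine permutation is a bijection $f:\mathbb{Z}\to\mathbb{Z}$ with $f(i+n)=f(i)+n$ for all $i$; it is bounded if $i\le f(i)\le i+n$ for all $i$; $\operatorname{Bound}(k,n)$ is the set of bounded $f$ with $\frac1n\sum_{i=1}^n(f(i)-i)=k$. For $f$ and integers $i,j$, $[i,j](f)=\{p<i : f(p)>j\}$. Indices of basis vectors are read modulo $n$, so $\langle[i,j]\rangle\subseteq\mathbb{C}^n$ for any integers $i\le j$, and $\operatorname{Proj}_X$ is the coordinate projection onto $\langle X\rangle$. For $f\in\operatorname{Bound}(k,n)$ the positroid variety $\Pi_f$ is the closure of $\{V\in\operatorname{Gr}(k,n):\dim\operatorname{Proj}_{[i,j]}V=k-\#[i,j](f)\text{ for all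 } i\le j\}$. Given $M$ as in the claim, let $\{c_1<\cdots<c_{n-k}\}=[n]\setminus\{a_1,\ldots,a_k\}$ and $\{d_1<\cdots<d_{n-k}\}=[n]\setminus\{b_1,\ldots,b_k\}$; $f_M$ is the affine permutation (with period $n$) mapping $b_i\mapsto a_i+n$ and $d_i\mapsto c_i$; it lies in $\operatorname{Bound}(k,n)$. *)

theory Defs
  imports "HOL-Analysis.Cartesian_Space" "Jordan_Normal_Form.Determinant"
begin

no_notation Matrix.vec_index (infixl "$" 100)

section \<open>Coordinates and the Grassmannian\<close>

definition coord_basis :: "(nat \<Rightarrow> complex^'n) \<Rightarrow> bool" where
  "coord_basis e \<longleftrightarrow> inj_on e {1..CARD('n)} \<and> vec.independent (e ` {1..CARD('n)})
     \<and> vec.span (e ` {1..CARD('n)}) = UNIV"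

definition coord :: "(nat \<Rightarrow> complex^'n) \<Rightarrow> complex^'n \<Rightarrow> nat \<Rightarrow> complex" where
  "coord e v i = vec.representation (e ` {1..CARD('n)}) v (e i)"

definition coord_span :: "(nat \<Rightarrow> complex^'n) \<Rightarrow> nat set \<Rightarrow> (complex^'n) set" where
  "coord_span e X = vec.span (e ` X)"

definition coord_proj :: "(nat \<Rightarrow> complex^'n) \<Rightarrow> nat set \<Rightarrow> complex^'n \<Rightarrow> complex^'n" where
  "coord_proj e X v = (\<Sum>i\<in>{1..CARD('n)} \<inter> X. coord e v i *s e i)"

definition Gr :: "nat \<Rightarrow> (complex^'n) set set" where
  "Gr k = {V. vec.subspace V \<and> vec.dim V = k}"

section \<open>The Zariski topology on the Grassmannian\<close>

text \<open>Homogeneous polynomials in variables indexed by \<open>X\<close>, taken as functions; since the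
  complex field is infinite, these are in bijection with formal polynomials in each degree.\<close>

inductive hom_poly :: "'i set \<Rightarrow> nat \<Rightarrow> (('i \<Rightarrow> complex) \<Rightarrow> complex) \<Rightarrow> bool"
  for X :: "'i set" where
  hom_poly_const: "hom_poly X 0 (\<lambda>_. c)"
| hom_poly_var: "i \<in> X \<Longrightarrow> hom_poly X 1 (\<lambda>x. x i)"
| hom_poly_add: "hom_poly X d F \<Longrightarrow> hom_poly X d G \<Longrightarrow> hom_poly X d (\<lambda>x. F x + G x)"
| hom_poly_mult: "hom_poly X d F \<Longrightarrow> hom_poly X d' G \<Longrightarrow> hom_poly X (d + d') (\<lambda>x. F x * G x)"

definition basis_of :: "nat \<Rightarrow> (nat \<Rightarrow> complex^'n) \<Rightarrow> (complex^'n) set \<Rightarrow> bool" where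
  "basis_of k v V \<longleftrightarrow> inj_on v {..<k} \<and> vec.independent (v ` {..<k}) \<and> vec.span (v ` {..<k}) = V"

definition plucker :: "(nat \<Rightarrow> complex^'n) \<Rightarrow> nat \<Rightarrow> (nat \<Rightarrow> complex^'n) \<Rightarrow> nat set \<Rightarrow> complex" where
  "plucker e k v I = Determinant.det (mat k k (\<lambda>(r, c). coord e (v r) (sorted_list_of_set I ! c)))"

text \<open>Closed sets are the traces of projective closed sets under the Pluecker embedding. The
  Pluecker vectors of two bases of \<open>V\<close> are proportional, so the vanishing of a homogeneous
  polynomial does not depend on the basis \<open>v\<close>. The basis \<open>e\<close> only serves to write down
  coordinates; another choice gives the same closed sets.\<close>

definition zariski_closed :: "(nat \<Rightarrow> complex^'n) \<Rightarrow> nat \<Rightarrow> (complex^'n) set set \<Rightarrow> bool" where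
  "zariski_closed e k Z \<longleftrightarrow>
     (\<exists>P. (\<forall>F\<in>P. \<exists>d. hom_poly {I. I \<subseteq> {1..CARD('n)} \<and> card I = k} d F) \<and>
          Z = {V \<in> Gr k. \<forall>v. basis_of k v V \<longrightarrow> (\<forall>F\<in>P. F (plucker e k v) = 0)})"

definition zariski_closure ::
  "(nat \<Rightarrow> complex^'n) \<Rightarrow> nat \<Rightarrow> (complex^'n) set set \<Rightarrow> (complex^'n) set set" where
  "zariski_closure e k A = \<Inter>{Z. zariski_closed e k Z \<and> A \<subseteq> Z}"

section \<open>Rank varieties\<close>

definition rank_set :: "nat set set \<Rightarrow> bool" where
  "rank_set M \<longleftrightarrow> finite M \<and> (\<forall>S\<in>M. \<exists>a b. 1 \<le> a \<and> a \<le> b \<and> S = {a..b})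
     \<and> inj_on Min M \<and> inj_on Max M"

definition intervals_in :: "nat set \<Rightarrow> nat set set \<Rightarrow> nat set set" where
  "intervals_in S M = {I \<in> M. I \<subseteq> S}"

definition rank_variety ::
  "(nat \<Rightarrow> complex^'n) \<Rightarrow> nat \<Rightarrow> nat set set \<Rightarrow> (complex^'n) set set" where
  "rank_variety e k M = zariski_closure e k
     {V \<in> Gr k. \<forall>S\<in>M. \<forall>T\<in>M.
        vec.dim (V \<inter> coord_span e (S \<inter> T)) = card (intervals_in (S \<inter> T) M)}"

section \<open>Positroid varieties\<close>

definition affine_perm :: "nat \<Rightarrow> (int \<Rightarrow> int) \<Rightarrow> bool" where
  "affine_perm n f \<longleftrightarrow> bij f \<and> (\<forall>i. f (i + int n) = f i + int n)"

definition Bound :: "nat \<Rightarrow> nat \<Rightarrow> (int \<Rightarrow> int) set" where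
  "Bound k n = {f. affine_perm n f \<and> (\<forall>i. i \<le> f i \<and> f i \<le> i + int n)
     \<and> 1 / real n * (\<Sum>i=1..int n. real_of_int (f i - i)) = real k}"

definition crossings :: "int \<Rightarrow> int \<Rightarrow> (int \<Rightarrow> int) \<Rightarrow> int set" where
  "crossings i j f = {p. p < i \<and> f p > j}"

text \<open>The representative of \<open>x\<close> modulo \<open>n\<close> in \<open>{1..n}\<close>.\<close>

definition residue :: "nat \<Rightarrow> int \<Rightarrow> nat" where
  "residue n x = nat ((x - 1) mod int n) + 1"

definition positroid_variety ::
  "(nat \<Rightarrow> complex^'n) \<Rightarrow> nat \<Rightarrow> (int \<Rightarrow> int) \<Rightarrow> (complex^'n) set set" where
  "positroid_variety e k f = zariski_closure e k
     {V \<in> Gr k. \<forall>i j. i \<le> j \<longrightarrow>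
        int (vec.dim (coord_proj e (residue CARD('n) ` {i..j}) ` V))
          = int k - int (card (crossings i j f))}"

section \<open>The bounded affine permutation of a rank set\<close>

definition rank_set_match :: "nat \<Rightarrow> nat set set \<Rightarrow> nat \<Rightarrow> nat" where
  "rank_set_match n M r =
     (if r \<in> Max ` M then Min (the_inv_into M Max r) + n
      else the (map_of (zip (sorted_list_of_set ({1..n} - Max ` M))
                            (sorted_list_of_set ({1..n} - Min ` M))) r))"

definition rank_set_perm :: "nat \<Rightarrow> nat set set \<Rightarrow> int \<Rightarrow> int" where
  "rank_set_perm n M x = int (rank_set_match n M (residue n x)) + (x - 1) div int n * int n"

lemma residue_shift:
  assumes "r \<in> {1..n}"
  shows "residue n (int r + q * int n) = r" "(int r + q * int n - 1) div int n = q"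
proof -
  have eq: "int r + q * int n - 1 = (int r - 1) + q * int n" by simp
  have *: "0 \<le> int r - 1" "int r - 1 < int n" using assms by auto
  show "residue n (int r + q * int n) = r"
    unfolding residue_def eq using * by simp
  show "(int r + q * int n - 1) div int n = q"
    unfolding eq using * by simp
qed

lemma residue_decomp:
  assumes "n \<ge> 1"
  shows "residue n x \<in> {1..n}" "x = int (residue n x) + (x - 1) div int n * int n"
proof -
  have *: "0 \<le> (x - 1) mod int n" "(x - 1) mod int n < int n" using assms by auto
  show "residue n x \<in> {1..n}" using * unfolding residue_def by auto
  have "(x - 1) div int n * int n + (x - 1) mod int n = x - 1" by simp
  with * show "x = int (residue n x) + (x - 1) div int n * int n"
    unfolding residue_def by simp
qed

lemma rank_set_perm_shift:
  assumes "r \<in> {1..n}"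
  shows "rank_set_perm n M (int r + q * int n) = int (rank_set_match n M r) + q * int n"
  unfolding rank_set_perm_def residue_shift[OF assms] ..

lemma rank_set_interval:
  assumes "rank_set M" "S \<in> M"
  shows "1 \<le> Min S" "Min S \<le> Max S"
proof -
  obtain a b where "1 \<le> a" "a \<le> b" "S = {a..b}"
    using assms unfolding rank_set_def by blast
  thus "1 \<le> Min S" "Min S \<le> Max S" by auto
qed

context
  fixes n :: nat and M :: "nat set set"
  assumes M: "rank_set M" and le: "\<And>S. S \<in> M \<Longrightarrow> Max S \<le> n"
begin

lemma rank_set_ends:
  "Min ` M \<subseteq> {1..n}" "Max ` M \<subseteq> {1..n}"
  "card ({1..n} - Min ` M) = n - card M" "card ({1..n} - Max ` M) = n - card M" "card M \<le> n"
proof -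
  show 1: "Min ` M \<subseteq> {1..n}" "Max ` M \<subseteq> {1..n}"
    using rank_set_interval[OF M] le by force+
  have 2: "card (Min ` M) = card M" "card (Max ` M) = card M"
    using M by (auto simp: rank_set_def card_image)
  show "card ({1..n} - Min ` M) = n - card M" "card ({1..n} - Max ` M) = n - card M"
    using 1 2 by (simp_all add: card_Diff_subset finite_subset)
  show "card M \<le> n"
    using card_mono[OF _ 1(1)] 2 by simp
qed

lemma rank_set_match_Max:
  assumes "S \<in> M"
  shows "rank_set_match n M (Max S) = Min S + n"
  using assms M by (simp add: rank_set_match_def rank_set_def the_inv_into_f_f)

lemma rank_set_match_gap:
  assumes "i < n - card M"
  shows "rank_set_match n M (sorted_list_of_set ({1..n} - Max ` M) ! i)
       = sorted_list_of_set ({1..n} - Min ` M) ! i"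
proof -
  let ?ds = "sorted_list_of_set ({1..n} - Max ` M)"
  let ?cs = "sorted_list_of_set ({1..n} - Min ` M)"
  have len: "length ?ds = n - card M" "length ?cs = n - card M"
    using rank_set_ends by simp_all
  have "?ds ! i \<in> set ?ds" using assms len by (metis nth_mem)
  hence "?ds ! i \<notin> Max ` M" by simp
  moreover have "map_of (zip ?ds ?cs) (?ds ! i) = Some (?cs ! i)"
    using assms len by (intro map_of_zip_nth) auto
  ultimately show ?thesis unfolding rank_set_match_def by simp
qed

lemma rank_set_perm_Max:
  assumes "S \<in> M"
  shows "rank_set_perm n M (int (Max S)) = int (Min S) + int n"
  using rank_set_perm_shift[of "Max S" n M 0] rank_set_match_Max[OF assms] rank_set_ends(2) assms
  by auto

lemma rank_set_perm_gap:
  assumes "i < n - card M"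
  shows "rank_set_perm n M (int (sorted_list_of_set ({1..n} - Max ` M) ! i))
       = int (sorted_list_of_set ({1..n} - Min ` M) ! i)"
proof -
  let ?ds = "sorted_list_of_set ({1..n} - Max ` M)"
  have "?ds ! i \<in> set ?ds" using assms rank_set_ends by (intro nth_mem) simp
  hence "?ds ! i \<in> {1..n}" by simp
  from rank_set_perm_shift[OF this, of M 0] rank_set_match_gap[OF assms] show ?thesis by simp
qed

lemma gaps_nth_le:
  assumes "i < n - card M"
  shows "sorted_list_of_set ({1..n} - Max ` M) ! i \<le> sorted_list_of_set ({1..n} - Min ` M) ! i"
proof (rule ccontr)
  let ?D = "{1..n} - Max ` M" and ?C = "{1..n} - Min ` M"
  let ?ds = "sorted_list_of_set ?D" and ?cs = "sorted_list_of_set ?C"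
  define x where "x = ?cs ! i"
  assume "\<not> ?thesis"
  hence less: "x < ?ds ! i" by (simp add: x_def)
  have len: "length ?ds = n - card M" "length ?cs = n - card M"
    using rank_set_ends by simp_all
  have "{d \<in> ?D. d \<le> x} \<subseteq> (!) ?ds ` {..<i}"
  proof
    fix d assume d: "d \<in> {d \<in> ?D. d \<le> x}"
    hence "d \<in> set ?ds" by simp
    then obtain j where j: "j < length ?ds" "?ds ! j = d" by (meson in_set_conv_nth)
    have "j < i"
    proof (rule ccontr)
      assume "\<not> j < i"
      hence "?ds ! i \<le> ?ds ! j" using j by (intro sorted_nth_mono) auto
      thus False using j d less by simp
    qed
    thus "d \<in> (!) ?ds ` {..<i}" using j by blast
  qed
  hence "card {d \<in> ?D. d \<le> x} \<le> card ((!) ?ds ` {..<i})" by (intro card_mono) auto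
  also have "\<dots> \<le> i" using card_image_le[of "{..<i}" "(!) ?ds"] by simp
  finally have D: "card {d \<in> ?D. d \<le> x} \<le> i" .
  have "(!) ?cs ` {..i} \<subseteq> {c \<in> ?C. c \<le> x}"
  proof safe
    fix j assume "j \<le> i"
    hence j: "j < length ?cs" using assms len by simp
    hence "?cs ! j \<in> set ?cs" by (rule nth_mem)
    thus "?cs ! j \<in> {1..n}" "\<And>S. ?cs ! j = Min S \<Longrightarrow> S \<in> M \<Longrightarrow> False" by auto
    show "?cs ! j \<le> x" unfolding x_def using \<open>j \<le> i\<close> assms len by (intro sorted_nth_mono) auto
  qed
  hence "card ((!) ?cs ` {..i}) \<le> card {c \<in> ?C. c \<le> x}" by (intro card_mono) auto
  moreover have "inj_on ((!) ?cs) {..i}"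
    using assms len by (intro inj_on_nth) auto
  ultimately have C: "Suc i \<le> card {c \<in> ?C. c \<le> x}" by (simp add: card_image)
  have fin: "finite M" and inj: "inj_on Min M" "inj_on Max M" using M by (auto simp: rank_set_def)
  have split: "card {c \<in> {1..n} - f ` M. c \<le> x} + card {S \<in> M. f S \<le> x} = card {c \<in> {1..n}. c \<le> x}"
    if f: "inj_on f M" "f ` M \<subseteq> {1..n}" for f
  proof -
    have "inj_on f {S \<in> M. f S \<le> x}" using f(1) by (rule inj_on_subset) auto
    hence "card {S \<in> M. f S \<le> x} = card (f ` {S \<in> M. f S \<le> x})" by (simp add: card_image)
    moreover have "{c \<in> {1..n}. c \<le> x} = {c \<in> {1..n} - f ` M. c \<le> x} \<union> f ` {S \<in> M. f S \<le> x}"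
      using f(2) by auto
    moreover have "{c \<in> {1..n} - f ` M. c \<le> x} \<inter> f ` {S \<in> M. f S \<le> x} = {}" by auto
    ultimately show ?thesis using fin by (simp add: card_Un_disjoint)
  qed
  have "card {S \<in> M. Max S \<le> x} \<le> card {S \<in> M. Min S \<le> x}"
    using fin rank_set_interval[OF M] by (intro card_mono) (auto intro: order_trans)
  with split[OF inj(1) rank_set_ends(1)] split[OF inj(2) rank_set_ends(2)] C D
  show False by linarith
qed

lemma rank_set_match_cases:
  assumes "r \<in> {1..n}"
  obtains (Max) S where "S \<in> M" "r = Max S" "rank_set_match n M r = Min S + n"
  | (gap) i where "i < n - card M" "r = sorted_list_of_set ({1..n} - Max ` M) ! i"
      "rank_set_match n M r = sorted_list_of_set ({1..n} - Min ` M) ! i"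
proof (cases "r \<in> Max ` M")
  case True
  thus thesis using Max rank_set_match_Max by blast
next
  case False
  hence "r \<in> set (sorted_list_of_set ({1..n} - Max ` M))" using assms by simp
  then obtain i where "i < length (sorted_list_of_set ({1..n} - Max ` M))"
    "sorted_list_of_set ({1..n} - Max ` M) ! i = r" by (meson in_set_conv_nth)
  thus thesis using gap rank_set_match_gap rank_set_ends by force
qed

lemma rank_set_match_bounds:
  assumes r: "r \<in> {1..n}"
  shows "r \<le> rank_set_match n M r" "rank_set_match n M r \<le> r + n"
proof -
  from r have "r \<le> rank_set_match n M r \<and> rank_set_match n M r \<le> r + n"
  proof (cases rule: rank_set_match_cases)
    case (Max S)
    thus ?thesis using rank_set_interval[OF M, of S] le[of S] by auto
  next
    case (gap i)
    have "sorted_list_of_set ({1..n} - Min ` M) ! i \<in> set (sorted_list_of_set ({1..n} - Min ` M))"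
      using gap(1) rank_set_ends by (intro nth_mem) simp
    hence "sorted_list_of_set ({1..n} - Min ` M) ! i \<le> n" by simp
    thus ?thesis using gap gaps_nth_le[OF gap(1)] by simp
  qed
  thus "r \<le> rank_set_match n M r" "rank_set_match n M r \<le> r + n" by auto
qed

lemma rank_set_match_residue_surj:
  assumes "s \<in> {1..n}"
  shows "\<exists>r\<in>{1..n}. rank_set_match n M r = (if s \<in> Min ` M then s + n else s)"
proof (cases "s \<in> Min ` M")
  case True
  then obtain S where "S \<in> M" "s = Min S" by blast
  thus ?thesis using True rank_set_match_Max[of S] rank_set_ends(2) by auto
next
  case False
  let ?cs = "sorted_list_of_set ({1..n} - Min ` M)"
  let ?ds = "sorted_list_of_set ({1..n} - Max ` M)"
  have "s \<in> set ?cs" using False assms by simp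
  then obtain i where i: "i < length ?cs" "?cs ! i = s" by (meson in_set_conv_nth)
  hence i': "i < n - card M" using rank_set_ends by simp
  hence "?ds ! i \<in> set ?ds" using rank_set_ends by (intro nth_mem) simp
  hence "?ds ! i \<in> {1..n}" by simp
  thus ?thesis using False rank_set_match_gap[OF i'] i by metis
qed

theorem rank_set_perm_Bound:
  assumes n: "n \<ge> 1"
  shows "rank_set_perm n M \<in> Bound (card M) n"
proof -
  let ?f = "rank_set_perm n M" and ?m = "rank_set_match n M"
  define t where "t s = (if s \<in> Min ` M then s + n else s)" for s
  have t_res: "residue n (int (t s)) = s" if "s \<in> {1..n}" for s
    using residue_shift(1)[OF that, of 0] residue_shift(1)[OF that, of 1] by (auto simp: t_def)
  have inj_t: "inj_on t {1..n}" by (rule inj_on_inverseI[where g = "\<lambda>y. residue n (int y)"]) (rule t_res)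
  have sub: "t ` {1..n} \<subseteq> ?m ` {1..n}"
  proof
    fix y assume "y \<in> t ` {1..n}"
    then obtain s where "s \<in> {1..n}" "y = t s" by blast
    moreover obtain r where "r \<in> {1..n}" "?m r = t s"
      using rank_set_match_residue_surj[OF \<open>s \<in> {1..n}\<close>] unfolding t_def by blast
    ultimately show "y \<in> ?m ` {1..n}" by (metis imageI)
  qed
  have "card (?m ` {1..n}) \<le> n" using card_image_le[of "{1..n}" ?m] by simp
  moreover have "card (t ` {1..n}) = n" using inj_t by (simp add: card_image)
  ultimately have img: "?m ` {1..n} = t ` {1..n}"
    using card_mono[OF _ sub] by (intro card_subset_eq[OF _ sub, symmetric]) auto
  have inj_m: "inj_on ?m {1..n}"
    using img \<open>card (t ` {1..n}) = n\<close> by (intro eq_card_imp_inj_on) auto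
  have period: "?f (x + int n) = ?f x + int n" for x
  proof -
    note d = residue_decomp[OF n, of x]
    have "?f (x + int n) = ?f (int (residue n x) + ((x - 1) div int n + 1) * int n)"
      using arg_cong[OF d(2), of "\<lambda>x. ?f (x + int n)"] by (simp add: algebra_simps)
    thus ?thesis
      unfolding rank_set_perm_shift[OF d(1)] by (simp add: rank_set_perm_def algebra_simps)
  qed
  have "inj ?f"
  proof (rule injI)
    fix x y assume eq: "?f x = ?f y"
    note dx = residue_decomp[OF n, of x] and dy = residue_decomp[OF n, of y]
    obtain s where s: "s \<in> {1..n}" "?m (residue n x) = t s" using dx(1) img by (metis image_iff)
    obtain s' where s': "s' \<in> {1..n}" "?m (residue n y) = t s'" using dy(1) img by (metis image_iff)
    have "\<exists>q. int (t s) = int s + q * int n" "\<exists>q. int (t s') = int s' + q * int n"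
      by (auto simp: t_def intro: exI[of _ 1] exI[of _ 0])
    then obtain q q' where q: "int (t s) = int s + q * int n" "int (t s') = int s' + q' * int n" by blast
    have "int s + (q + (x - 1) div int n) * int n = int s' + (q' + (y - 1) div int n) * int n"
      using eq s s' q by (simp add: rank_set_perm_def algebra_simps)
    hence "s = s'" using residue_shift(1)[OF s(1)] residue_shift(1)[OF s'(1)] by metis
    hence m: "?m (residue n x) = ?m (residue n y)" using s s' by simp
    hence r: "residue n x = residue n y" using inj_m dx(1) dy(1) by (meson inj_onD)
    have "(x - 1) div int n * int n = (y - 1) div int n * int n"
      using eq r by (simp add: rank_set_perm_def)
    thus "x = y" using dx(2) dy(2) r by metis
  qed
  moreover have "surj ?f"
  proof (rule surjI)
    fix y
    show "?f (SOME x. ?f x = y) = y"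
    proof (rule someI_ex)
      note d = residue_decomp[OF n, of y]
      let ?s = "residue n y" and ?q = "(y - 1) div int n"
      obtain r where r: "r \<in> {1..n}" "?m r = t ?s" using d(1) img by (metis image_iff)
      have "\<exists>q. int (t ?s) = int ?s + q * int n"
        by (auto simp: t_def intro: exI[of _ 1] exI[of _ 0])
      then obtain q where q: "int (t ?s) = int ?s + q * int n" by blast
      have "?f (int r + (?q - q) * int n) = y"
        unfolding rank_set_perm_shift[OF r(1)] r(2) q using d(2) by (simp add: algebra_simps)
      thus "\<exists>x. ?f x = y" by blast
    qed
  qed
  ultimately have "affine_perm n ?f" using period by (simp add: affine_perm_def bij_def)
  moreover have "x \<le> ?f x \<and> ?f x \<le> x + int n" for x
  proof -
    note d = residue_decomp[OF n, of x]
    have "?f x = int (?m (residue n x)) + (x - 1) div int n * int n" by (simp add: rank_set_perm_def)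
    thus ?thesis using rank_set_match_bounds[OF d(1)] d(2) by linarith
  qed
  moreover have "(\<Sum>i=1..int n. ?f i - i) = int (card M) * int n"
  proof -
    have "(\<Sum>i=1..int n. ?f i - i) = (\<Sum>r=1..n. ?f (int r) - int r)"
    proof (rule sum.reindex_bij_betw[symmetric])
      show "bij_betw int {1..n} {1..int n}"
        using image_int_atLeastAtMost[of 1 n] by (simp add: bij_betw_def)
    qed
    also have "\<dots> = (\<Sum>r=1..n. int (?m r) - int r)"
    proof (rule sum.cong)
      fix r assume "r \<in> {1..n}"
      from rank_set_perm_shift[OF this, of M 0]
      show "?f (int r) - int r = int (?m r) - int r" by simp
    qed simp
    also have "\<dots> = (\<Sum>r=1..n. int (?m r)) - (\<Sum>r=1..n. int r)" by (simp add: sum_subtractf)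
    also have "(\<Sum>r=1..n. int (?m r)) = sum int (?m ` {1..n})"
      using inj_m by (simp add: sum.reindex)
    also have "\<dots> = (\<Sum>s=1..n. int (t s))" unfolding img using inj_t by (simp add: sum.reindex)
    also have "\<dots> = (\<Sum>s=1..n. int s + (if s \<in> Min ` M then int n else 0))"
      by (rule sum.cong) (auto simp: t_def)
    also have "\<dots> = (\<Sum>s=1..n. int s) + (\<Sum>s\<in>{1..n} \<inter> Min ` M. int n)"
      by (simp only: sum.distrib sum.inter_restrict[OF finite_atLeastAtMost])
    also have "{1..n} \<inter> Min ` M = Min ` M" using rank_set_ends(1) by blast
    also have "(\<Sum>s\<in>Min ` M. int n) = int (card M) * int n"
      using M by (simp add: card_image rank_set_def)
    finally show ?thesis by simp
  qed
  hence "real_of_int (\<Sum>i=1..int n. ?f i - i) = real_of_int (int (card M) * int n)" by (rule arg_cong)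
  hence "(\<Sum>i=1..int n. real_of_int (?f i - i)) = real (card M) * real n"
    by (simp only: of_int_sum of_int_mult of_int_of_nat_eq)
  ultimately show ?thesis using n by (simp add: Bound_def)
qed

end

end

theory Submission
  imports Defs "HOL-Analysis.Determinants" "HOL-Analysis.Line_Segment"
begin

text \<open>
  The rank conditions for the pairs \<open>S, T \<in> M\<close> force \<open>V\<close> to have a basis with one vector in each
  \<open>\<langle>S\<rangle>\<close>, \<open>S \<in> M\<close>. For such \<open>V\<close> the projection to a cyclic interval \<open>Y\<close> has dimension at most the
  minimum of \<open>|Y|\<close> and the number of intervals of \<open>M\<close> meeting \<open>Y\<close>. This minimum is exactly
  \<open>k - #[i,j](f\<^sub>M)\<close>, and it is attained for generic basis vectors, because a matching of that size
  between \<open>M\<close> and \<open>Y\<close> exists.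

  The open set defining the positroid variety is contained in the one defining the rank variety, by
  rank-nullity. Conversely, if \<open>V\<close> is in the latter, the line from its adapted basis to a generic one
  consists, up to finitely many parameters, of subspaces in the former; a polynomial vanishing on the
  former vanishes at \<open>V\<close> by continuity.
\<close>

section \<open>Linear algebra\<close>

text \<open>Rank-nullity for the restriction of \<open>f\<close> to \<open>V\<close>: a right
  inverse \<open>g\<close> on the image splits \<open>V\<close> as the direct sum of the kernel and
  an isomorphic copy of the image.\<close>

lemma dim_image_plus_dim_kernel:
  fixes V :: "('a::field^'m) set" and f :: "'a^'m \<Rightarrow> 'a^'l"
  assumes f: "Vector_Spaces.linear (*s) (*s) f" and V: "vec.subspace V"
  shows "vec.dim (f ` V) + vec.dim {x \<in> V. f x = 0} = vec.dim V"
proof -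
  define K where "K = {x \<in> V. f x = 0}"
  have K: "vec.subspace K"
    using vec.subspace_inter[OF V vec.linear_subspace_kernel[OF f]]
    by (simp add: K_def Collect_conj_eq)
  obtain g where g: "range g \<subseteq> V" "Vector_Spaces.linear (*s) (*s) g" "\<And>y. y \<in> f ` V \<Longrightarrow> f (g y) = y"
    using vec.linear_exists_right_inverse_on[OF f V] by blast
  have fV: "vec.subspace (f ` V)" using f V by (rule vec.linear_subspace_image)
  have gfV: "vec.subspace (g ` f ` V)" using g(2) fV by (rule vec.linear_subspace_image)
  have "inj_on g (vec.span (f ` V))"
    using g(3) fV by (metis inj_on_inverseI vec.span_eq_iff)
  hence "vec.dim (g ` f ` V) = vec.dim (f ` V)" by (rule vec.dim_image_eq[OF g(2)])
  moreover have "K \<inter> g ` f ` V = {0}"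
  proof (intro equalityI subsetI)
    fix z assume "z \<in> K \<inter> g ` f ` V"
    then obtain y where "y \<in> f ` V" "z = g y" "f z = 0" by (auto simp: K_def)
    thus "z \<in> {0}" using g(3)[of y] vec.linear_0[OF g(2)] by simp
  qed (use vec.subspace_0[OF K] vec.subspace_0[OF gfV] in auto)
  moreover have "{x + y | x y. x \<in> K \<and> y \<in> g ` f ` V} = V"
  proof (intro equalityI subsetI)
    fix v assume "v \<in> V"
    moreover have "g (f v) \<in> V" using g(1) by blast
    ultimately have "v - g (f v) \<in> K"
      using g(3) V by (simp add: K_def vec.subspace_diff vec.linear_diff[OF f])
    thus "v \<in> {x + y | x y. x \<in> K \<and> y \<in> g ` f ` V}" using \<open>v \<in> V\<close>
      by (intro CollectI exI[of _ "v - g (f v)"] exI[of _ "g (f v)"]) auto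
  next
    fix v assume "v \<in> {x + y | x y. x \<in> K \<and> y \<in> g ` f ` V}"
    thus "v \<in> V" using g(1) V by (auto simp: K_def intro!: vec.subspace_add)
  qed
  ultimately show ?thesis using vec.dim_sums_Int[OF K gfV] by (simp add: K_def)
qed

text \<open>The determinant of 1 + t f is a polynomial in t with value 1 at 0, hence nonzero with
  finitely many roots.\<close>

lemma finite_not_inj_id_plus_scaled:
  fixes f :: "'a::field^'m \<Rightarrow> 'a^'m"
  assumes f: "Vector_Spaces.linear (*s) (*s) f"
  shows "finite {t. \<not> inj (\<lambda>x. x + t *s f x)}"
proof -
  define A :: "'a \<Rightarrow> 'a^'m^'m" where "A t = (\<chi> i j. (if i = j then 1 else 0) + t * matrix f $ i $ j)" for t
  \<comment> \<open>The Leibniz expansion with the entries of \<open>A t\<close> written as linear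
    polynomials, so that evaluation at t gives the determinant of \<open>A t\<close>.\<close>
  define p where "p = (\<Sum>\<pi> | \<pi> permutes (UNIV :: 'm set). of_int (sign \<pi>) *
      (\<Prod>i\<in>UNIV. [:if i = \<pi> i then 1 else 0, matrix f $ i $ \<pi> i:]))"
  have det: "poly p t = Determinants.det (A t)" for t
    by (simp add: p_def Determinants.det_def A_def poly_sum poly_prod)
  have A: "A t *v x = x + t *s f x" for t x
  proof -
    have "A t = Finite_Cartesian_Product.mat 1 + (\<chi> i j. t * matrix f $ i $ j)"
      by (simp add: A_def Finite_Cartesian_Product.vec_eq_iff Finite_Cartesian_Product.mat_def)
    moreover have "(\<chi> i j. t * matrix f $ i $ j) *v x = t *s (matrix f *v x)"
      by (simp add: Finite_Cartesian_Product.vec_eq_iff matrix_vector_mult_def sum_distrib_left mult.assoc)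
    ultimately show ?thesis
      using matrix_works[OF f] by (simp add: matrix_vector_mult_add_rdistrib)
  qed
  have "A 0 = Finite_Cartesian_Product.mat 1" by (simp add: A_def Finite_Cartesian_Product.vec_eq_iff Finite_Cartesian_Product.mat_def)
  hence "poly p 0 = 1" by (simp add: det Determinants.det_I)
  hence "p \<noteq> 0" by auto
  hence "finite {t. poly p t = 0}" by (rule poly_roots_finite)
  moreover have "{t. \<not> inj (\<lambda>x. x + t *s f x)} \<subseteq> {t. poly p t = 0}"
  proof (clarify, rule ccontr)
    fix t assume t: "\<not> inj (\<lambda>x. x + t *s f x)" "poly p t \<noteq> 0"
    hence "Finite_Cartesian_Product.invertible (A t)" by (simp add: Determinants.invertible_det_nz det)
    hence "inj ((*v) (A t))" by (simp add: inj_matrix_vector_mult)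
    moreover have "(*v) (A t) = (\<lambda>x. x + t *s f x)" by (simp add: A fun_eq_iff)
    ultimately show False using t(1) by simp
  qed
  ultimately show ?thesis by (rule rev_finite_subset)
qed

text \<open>A basis among the \<open>x i\<close> is moved by a linear map \<open>1 + t f\<close>, whose determinant is a
  polynomial in \<open>t\<close> with value 1 at 0.\<close>

lemma finite_dim_perturbation_drop:
  fixes x y :: "'i \<Rightarrow> 'a::field^'m"
  assumes "finite I"
  shows "finite {t. vec.dim ((\<lambda>i. x i + t *s y i) ` I) < vec.dim (x ` I)}"
proof -
  obtain B where B: "B \<subseteq> x ` I" "vec.independent B" "x ` I \<subseteq> vec.span B"
    using vec.maximal_independent_subset by blast
  then obtain J where J: "J \<subseteq> I" "inj_on x J" "B = x ` J"
    by (meson subset_image_inj)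
  \<comment> \<open>On \<open>B\<close> the map sends \<open>x i\<close> to \<open>y i\<close>, with
    \<open>inv_into\<close> recovering the index in \<open>J\<close>; so 1 + t f takes
    \<open>B\<close> into the perturbed family.\<close>
  obtain f where f: "Vector_Spaces.linear (*s) (*s) f" "\<And>z. z \<in> B \<Longrightarrow> f z = y (inv_into J x z)"
    using vec.linear_independent_extend[OF B(2), of "\<lambda>z. y (inv_into J x z)"] by blast
  have dim: "vec.dim (x ` I) \<le> vec.dim ((\<lambda>i. x i + t *s y i) ` I)" if inj: "inj (\<lambda>z. z + t *s f z)" for t
  proof -
    define g where "g z = z + t *s f z" for z
    have g: "Vector_Spaces.linear (*s) (*s) g"
      unfolding g_def using f(1)
      by (intro vec.linear_compose_add vec.linear_ident vec.linear_compose_scale_right)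
    have "inj g" using inj unfolding g_def .
    have "g ` B = (\<lambda>i. x i + t *s y i) ` J"
      unfolding J(3) image_image by (rule image_cong) (use f(2) J in \<open>auto simp: g_def\<close>)
    hence "g ` B \<subseteq> (\<lambda>i. x i + t *s y i) ` I" using J(1) by auto
    hence "vec.dim (g ` B) \<le> vec.dim ((\<lambda>i. x i + t *s y i) ` I)" by (rule vec.dim_subset)
    moreover have "vec.dim (g ` B) = vec.dim B"
      using g \<open>inj g\<close> by (intro vec.dim_image_eq) (auto intro: inj_on_subset)
    moreover have "vec.dim (x ` I) \<le> vec.dim B" using B(3) by (rule vec.dim_mono)
    ultimately show ?thesis by simp
  qed
  show ?thesis
    by (rule finite_subset[OF _ finite_not_inj_id_plus_scaled[OF f(1)]]) (use dim in \<open>auto simp: not_less[symmetric]\<close>)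
qed

text \<open>The segment is a perturbation of \<open>x\<close> by t (y - x) and, read from the other
  end, of \<open>y\<close> by (1 - t) (x - y); each view excludes finitely many t.\<close>

lemma finite_dim_segment_drop:
  fixes x y :: "'i \<Rightarrow> 'a::field^'m"
  assumes I: "finite I"
  shows "finite {t. vec.dim ((\<lambda>i. (1 - t) *s x i + t *s y i) ` I) < max (vec.dim (x ` I)) (vec.dim (y ` I))}"
    (is "finite ?B")
proof -
  define p q where "p t = vec.dim ((\<lambda>i. x i + t *s (y i - x i)) ` I)"
    and "q t = vec.dim ((\<lambda>i. y i + t *s (x i - y i)) ` I)" for t
  have eq: "(1 - t) *s x i + t *s y i = x i + t *s (y i - x i)"
    "(1 - t) *s x i + t *s y i = y i + (1 - t) *s (x i - y i)" for t i
    by (simp_all add: vec.scale_left_diff_distrib vec.scale_right_diff_distrib)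
  have "finite {t. p t < vec.dim (x ` I)}" "finite {t. q t < vec.dim (y ` I)}"
    unfolding p_def q_def using I by (rule finite_dim_perturbation_drop)+
  hence "finite ({t. p t < vec.dim (x ` I)} \<union> (\<lambda>t. 1 - t) ` {t. q t < vec.dim (y ` I)})" by simp
  moreover have "?B \<subseteq> {t. p t < vec.dim (x ` I)} \<union> (\<lambda>t. 1 - t) ` {t. q t < vec.dim (y ` I)}"
  proof
    fix t assume "t \<in> ?B"
    hence "p t < vec.dim (x ` I) \<or> q (1 - t) < vec.dim (y ` I)"
      unfolding p_def q_def eq(1)[symmetric] eq(2)[symmetric] by (simp add: less_max_iff_disj)
    thus "t \<in> {t. p t < vec.dim (x ` I)} \<union> (\<lambda>t. 1 - t) ` {t. q t < vec.dim (y ` I)}"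
      by (auto intro: image_eqI[of _ _ "1 - t"])
  qed
  ultimately show ?thesis by (rule rev_finite_subset)
qed

section \<open>Coordinates, coordinate subspaces and projections\<close>

context
  fixes e :: "nat \<Rightarrow> complex^'n"
  assumes e: "coord_basis e"
begin

lemma coord_add: "coord e (x + y) i = coord e x i + coord e y i"
  and coord_scale: "coord e (c *s x) i = c * coord e x i"
  and coord_sum: "coord e (sum f A) i = (\<Sum>a\<in>A. coord e (f a) i)"
  using e by (simp_all add: coord_def coord_basis_def vec.representation_add vec.representation_scale
      vec.representation_sum)

lemma coord_basis_vector:
  assumes "i \<in> {1..CARD('n)}" "j \<in> {1..CARD('n)}"
  shows "coord e (e j) i = (if i = j then 1 else 0)"
  using assms e by (auto simp: coord_def coord_basis_def vec.representation_basis inj_on_eq_iff)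

lemma coord_expansion: "(\<Sum>i\<in>{1..CARD('n)}. coord e x i *s e i) = x"
proof -
  have "(\<Sum>b\<in>e ` {1..CARD('n)}. vec.representation (e ` {1..CARD('n)}) x b *s b) = x"
    using e by (intro vec.sum_representation_eq) (auto simp: coord_basis_def)
  thus ?thesis using e by (simp add: coord_def coord_basis_def sum.reindex)
qed

text \<open>As \<open>coord_basis\<close> constrains \<open>e\<close> only on
  \<open>{1..CARD('n)}\<close>, the index set is required to lie there.\<close>

lemma mem_coord_span_iff:
  assumes X: "X \<subseteq> {1..CARD('n)}"
  shows "x \<in> coord_span e X \<longleftrightarrow> (\<forall>i\<in>{1..CARD('n)} - X. coord e x i = 0)"
proof
  assume "x \<in> coord_span e X"
  hence "x \<in> vec.span (e ` X)" by (simp add: coord_span_def)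
  thus "\<forall>i\<in>{1..CARD('n)} - X. coord e x i = 0"
  proof (induction rule: vec.span_induct_alt)
    case base
    show ?case using coord_scale[of 0 0] by simp
  next
    case (step c y z)
    thus ?case using X by (auto simp: coord_add coord_scale coord_basis_vector subset_iff)
  qed
next
  assume *: "\<forall>i\<in>{1..CARD('n)} - X. coord e x i = 0"
  have "(\<Sum>i\<in>{1..CARD('n)}. coord e x i *s e i) = (\<Sum>i\<in>X. coord e x i *s e i)"
    using X * by (intro sum.mono_neutral_right) auto
  hence "x = (\<Sum>i\<in>X. coord e x i *s e i)" by (simp only: coord_expansion)
  also have "\<dots> \<in> coord_span e X"
    unfolding coord_span_def by (intro vec.span_sum vec.span_scale vec.span_base) auto
  finally show "x \<in> coord_span e X" .
qed

lemma coord_span_Int: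
  assumes "X \<subseteq> {1..CARD('n)}" "Y \<subseteq> {1..CARD('n)}"
  shows "coord_span e X \<inter> coord_span e Y = coord_span e (X \<inter> Y)"
  using assms by (auto simp: mem_coord_span_iff le_infI1)

lemma linear_coord_proj: "Vector_Spaces.linear (*s) (*s) (coord_proj e X)"
  by unfold_locales
    (simp_all add: coord_proj_def coord_add coord_scale sum.distrib vec.scale_sum_right
      vec.scale_left_distrib vector_smult_assoc)

lemma coord_coord_proj:
  assumes "i \<in> {1..CARD('n)}"
  shows "coord e (coord_proj e X x) i = (if i \<in> X then coord e x i else 0)"
proof -
  have "coord e (coord_proj e X x) i = (\<Sum>j\<in>{1..CARD('n)} \<inter> X. if i = j then coord e x j else 0)"
    unfolding coord_proj_def coord_sum coord_scale
    by (rule sum.cong) (use assms in \<open>auto simp: coord_basis_vector\<close>)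
  thus ?thesis using assms by simp
qed

lemma coord_proj_eq_0_iff: "coord_proj e X x = 0 \<longleftrightarrow> x \<in> coord_span e ({1..CARD('n)} - X)"
proof
  assume "coord_proj e X x = 0"
  hence "coord e x i = 0" if "i \<in> {1..CARD('n)}" "i \<in> X" for i
    using coord_coord_proj[OF that(1), of X x] coord_scale[of 0 0 i] that(2) by simp
  thus "x \<in> coord_span e ({1..CARD('n)} - X)" by (subst mem_coord_span_iff) auto
next
  assume "x \<in> coord_span e ({1..CARD('n)} - X)"
  thus "coord_proj e X x = 0" by (subst (asm) mem_coord_span_iff) (auto simp: coord_proj_def)
qed

lemma coord_proj_basis_vector:
  assumes "i \<in> {1..CARD('n)} \<inter> X"
  shows "coord_proj e X (e i) = e i"
proof -
  have "coord_proj e X (e i) = (\<Sum>j\<in>{1..CARD('n)} \<inter> X. if j = i then e j else 0)"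
    unfolding coord_proj_def by (rule sum.cong) (use assms in \<open>auto simp: coord_basis_vector\<close>)
  thus ?thesis using assms by (simp add: sum.delta)
qed

lemma dim_coord_proj_image_le:
  assumes "finite X" shows "vec.dim (coord_proj e X ` V) \<le> card X"
proof -
  have "coord_proj e X ` V \<subseteq> vec.span (e ` X)"
    unfolding coord_proj_def by (intro image_subsetI vec.span_sum vec.span_scale vec.span_base) auto
  hence "vec.dim (coord_proj e X ` V) \<le> card (e ` X)" using assms by (intro vec.dim_le_card) auto
  also have "\<dots> \<le> card X" using assms by (rule card_image_le)
  finally show ?thesis .
qed

text \<open>The kernel of the projection to \<open>X\<close> is the span of the other basis vectors,
  so rank-nullity converts projection ranks into intersection dimensions.\<close>

lemma dim_coord_proj_plus_dim_Int:
  assumes "vec.subspace V"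
  shows "vec.dim (coord_proj e X ` V) + vec.dim (V \<inter> coord_span e ({1..CARD('n)} - X)) = vec.dim V"
proof -
  have "V \<inter> coord_span e ({1..CARD('n)} - X) = {x \<in> V. coord_proj e X x = 0}"
    by (auto simp: coord_proj_eq_0_iff)
  thus ?thesis using dim_image_plus_dim_kernel[OF linear_coord_proj assms] by simp
qed

end

section \<open>Matchings and crossings\<close>

text \<open>The largest dimension of the projection to the coordinates in \<open>Y\<close> of the span of vectors
  \<open>v S \<in> \<langle>S\<rangle>\<close>, \<open>S \<in> M\<close>, when \<open>Y\<close> is a cyclic interval.\<close>

definition generic_rank :: "nat set set \<Rightarrow> nat set \<Rightarrow> nat" where
  "generic_rank M Y = min (card {S \<in> M. S \<inter> Y \<noteq> {}}) (card Y)"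

text \<open>Positions are served from left to right, each by the available interval that ends first. No
  interval expires unserved, because right ends are distinct; and the pool of waiting intervals never
  grows, because left ends are distinct, so if an interval is left over then every position is taken.\<close>

lemma interval_matching:
  fixes a b :: "'i \<Rightarrow> nat"
  assumes "finite L" "inj_on a L" "inj_on b L" "\<And>l. l \<in> L \<Longrightarrow> a l \<le> b l \<and> a l \<le> j \<and> i \<le> b l"
  shows "\<exists>J m. J \<subseteq> L \<and> card J = min (card L) (Suc j - i) \<and> inj_on m J
    \<and> (\<forall>l\<in>J. m l \<in> {a l..b l} \<inter> {i..j})"
  using assms
proof (induction "Suc j - i" arbitrary: i L)
  case 0
  thus ?case by (intro exI[of _ "{}"]) auto
next
  case (Suc d)
  hence ij: "i \<le> j" by simp
  show ?case
  proof (cases "\<exists>l\<in>L. a l \<le> i")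
    case False
    hence *: "i < a l" if "l \<in> L" for l using that by (auto simp: not_le)
    \<comment> \<open>Nothing has started at \<open>i\<close> yet, so every interval can take its
      own left end; these are distinct and lie in \<open>{Suc i..j}\<close>.\<close>
    have "card L = card (a ` L)" using Suc.prems by (simp add: card_image)
    also have "\<dots> \<le> card {Suc i..j}"
      using * Suc.prems(4) by (intro card_mono) (auto simp: Suc_le_eq)
    finally have "min (card L) (Suc j - i) = card L" by simp
    thus ?thesis using Suc.prems *
      by (intro exI[of _ L] exI[of _ a]) (auto intro: less_imp_le)
  next
    case True
    define L1 where "L1 = {l \<in> L. a l \<le> i}"
    have "finite L1" "L1 \<noteq> {}" using True Suc.prems(1) by (auto simp: L1_def)
    then obtain l0 where l0: "l0 \<in> L1" "\<And>l. l \<in> L1 \<Longrightarrow> b l0 \<le> b l"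
      by (metis arg_min_least arg_min_if_finite(1))
    have l0L: "l0 \<in> L" using l0 by (simp add: L1_def)
    have pos: "0 < card L" using l0L Suc.prems(1) card_gt_0_iff by blast
    \<comment> \<open>An unserved interval ending at \<open>i\<close> would share its right end with
      \<open>l0\<close>, which ends first among the started ones.\<close>
    have "a l \<le> b l \<and> a l \<le> j \<and> Suc i \<le> b l" if l: "l \<in> L - {l0}" for l
    proof (rule ccontr)
      assume "\<not> ?thesis"
      hence "b l = i" using l Suc.prems(4)[of l] by auto
      hence "l \<in> L1" using l Suc.prems(4)[of l] by (auto simp: L1_def)
      hence "b l0 = b l" using l0 l0L Suc.prems(4)[of l0] \<open>b l = i\<close> by force
      thus False using l l0L Suc.prems(3) by (auto dest: inj_onD)
    qed
    moreover have "d = Suc j - Suc i" using Suc.hyps(2) by simp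
    ultimately obtain J m where J: "J \<subseteq> L - {l0}" "card J = min (card (L - {l0})) (Suc j - Suc i)"
      "inj_on m J" "\<forall>l\<in>J. m l \<in> {a l..b l} \<inter> {Suc i..j}"
      using Suc.hyps(1)[of "Suc i" "L - {l0}"] Suc.prems(1-3)
      by (metis (no_types, lifting) finite_Diff inj_on_diff)
    have "finite J" "l0 \<notin> J" using J(1) Suc.prems(1) by (auto intro: finite_subset)
    hence "card (insert l0 J) = min (card L) (Suc j - i)"
      using J(2) l0L Suc.prems(1) pos ij by simp
    moreover have "inj_on (m(l0 := i)) (insert l0 J)"
      using J(3,4) \<open>l0 \<notin> J\<close> by (force simp: inj_on_def)
    moreover have "\<forall>l\<in>insert l0 J. (m(l0 := i)) l \<in> {a l..b l} \<inter> {i..j}"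
      using J(4) \<open>l0 \<notin> J\<close> l0(1) l0L Suc.prems(4) ij by (auto simp: L1_def)
    ultimately show ?thesis using J(1) l0L by blast
  qed
qed

text \<open>Turns comparisons with the q-th gap into counts of gaps. List positions start at 0, so
  the entries below \<open>x\<close> occupy exactly the positions below their number.\<close>

lemma nth_sorted_list_of_set_less_iff:
  fixes D :: "'a::linorder set"
  assumes D: "finite D" and q: "q < card D"
  shows "sorted_list_of_set D ! q < x \<longleftrightarrow> q < card {d \<in> D. d < x}"
proof
  let ?ds = "sorted_list_of_set D"
  have len: "length ?ds = card D" by simp
  show "q < card {d \<in> D. d < x}" if "?ds ! q < x"
  proof -
    have "(!) ?ds ` {..q} \<subseteq> {d \<in> D. d < x}"
    proof safe
      fix r assume "r \<le> q"
      hence "r < length ?ds" using q by simp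
      hence "?ds ! r \<in> set ?ds" by (rule nth_mem)
      thus "?ds ! r \<in> D" using D by simp
      have "?ds ! r \<le> ?ds ! q" using \<open>r \<le> q\<close> q by (intro sorted_nth_mono) auto
      thus "?ds ! r < x" using that by simp
    qed
    hence "card ((!) ?ds ` {..q}) \<le> card {d \<in> D. d < x}" using D by (intro card_mono) auto
    moreover have "inj_on ((!) ?ds) {..q}" using q by (intro inj_on_nth) auto
    ultimately show ?thesis by (simp add: card_image)
  qed
  show "?ds ! q < x" if "q < card {d \<in> D. d < x}"
  proof (rule ccontr)
    assume ge: "\<not> ?ds ! q < x"
    have "{d \<in> D. d < x} \<subseteq> (!) ?ds ` {..<q}"
    proof
      fix d assume d: "d \<in> {d \<in> D. d < x}"
      hence "d \<in> set ?ds" using D by simp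
      then obtain r where r: "r < length ?ds" "?ds ! r = d" by (meson in_set_conv_nth)
      have "r < q"
      proof (rule ccontr)
        assume "\<not> r < q"
        hence "?ds ! q \<le> ?ds ! r" using r by (intro sorted_nth_mono) auto
        thus False using r d ge by auto
      qed
      thus "d \<in> (!) ?ds ` {..<q}" using r by blast
    qed
    hence "card {d \<in> D. d < x} \<le> card ((!) ?ds ` {..<q})" by (intro card_mono) auto
    also have "\<dots> \<le> q" using card_image_le[of "{..<q}" "(!) ?ds"] by simp
    finally show False using that by simp
  qed
qed

section \<open>Residues and translation by the period\<close>

lemma residue_translate:
  assumes "n \<ge> 1"
  shows "residue n (x + q * int n) = residue n x"
    and "(x + q * int n - 1) div int n = (x - 1) div int n + q"
  using residue_shift[OF residue_decomp(1)[OF assms, of x], of "(x - 1) div int n + q"]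
    residue_decomp(2)[OF assms, of x] by (simp_all add: algebra_simps)

lemma rank_set_perm_translate:
  assumes "n \<ge> 1"
  shows "rank_set_perm n M (x + q * int n) = rank_set_perm n M x + q * int n"
  by (simp add: rank_set_perm_def residue_translate[OF assms] algebra_simps)

lemma residue_image_translate:
  assumes "n \<ge> 1"
  shows "residue n ` {i + q * int n..j + q * int n} = residue n ` {i..j}"
proof -
  have "{i + q * int n..j + q * int n} = (\<lambda>x. x + q * int n) ` {i..j}" by simp
  thus ?thesis using assms by (simp only: image_image residue_translate(1))
qed

lemma card_crossings_translate:
  assumes "n \<ge> 1"
  shows "card (crossings (i + q * int n) (j + q * int n) (rank_set_perm n M))
    = card (crossings i j (rank_set_perm n M))"
proof -
  have "crossings (i + q * int n) (j + q * int n) (rank_set_perm n M)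
    = (\<lambda>p. p + q * int n) ` crossings i j (rank_set_perm n M)" (is "?A = ?g ` ?B")
  proof (intro equalityI subsetI)
    fix p assume "p \<in> ?A"
    hence "p - q * int n \<in> ?B"
      using rank_set_perm_translate[OF assms, of M "p - q * int n" q] by (simp add: crossings_def)
    thus "p \<in> ?g ` ?B" by (intro image_eqI[of _ _ "p - q * int n"]) auto
  qed (auto simp: crossings_def rank_set_perm_translate[OF assms])
  thus ?thesis by (simp add: card_image)
qed

lemma residue_eq_nat:
  assumes "1 \<le> x" "x \<le> int n"
  shows "residue n x = nat x"
  using residue_shift(1)[of "nat x" n 0] assms by (simp add: nat_le_iff le_nat_iff)

lemma residue_image_straight:
  assumes "1 \<le> i" "j \<le> n"
  shows "residue n ` {int i..int j} = {i..j}"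
proof -
  have "residue n ` {int i..int j} = nat ` {int i..int j}"
    using assms by (intro image_cong refl residue_eq_nat) auto
  also have "\<dots> = {i..j}" unfolding image_int_atLeastAtMost[symmetric] image_image by simp
  finally show ?thesis .
qed


text \<open>Beyond \<open>n\<close> the residues start again at 1; splitting there and shifting the
  second piece by one period leaves the positions on both sides of \<open>{s..t}\<close>.\<close>

lemma residue_image_wrap:
  assumes "1 \<le> s" "s \<le> t" "t \<le> n"
  shows "residue n ` {int t + 1..int s + int n - 1} = {1..n} - {s..t}"
proof -
  have split: "{int t + 1..int s + int n - 1}
    = {int (t + 1)..int n} \<union> {int 1 + 1 * int n..int (s - 1) + 1 * int n}"
    using assms by auto
  have "residue n ` {int t + 1..int s + int n - 1} = {t + 1..n} \<union> {1..s - 1}"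
    unfolding split image_Un
    using assms by (subst residue_image_translate) (auto simp only: residue_image_straight)
  thus ?thesis using assms by auto
qed

lemma residue_image_full:
  assumes "n \<ge> 1" "i + int n - 1 \<le> j"
  shows "residue n ` {i..j} = {1..n}"
proof (intro equalityI subsetI)
  fix r assume r: "r \<in> {1..n}"
  \<comment> \<open>The member of \<open>{i..i + int n - 1}\<close> congruent to \<open>r\<close>
    modulo \<open>n\<close>.\<close>
  define x where "x = i + (int r - i) mod int n"
  have "0 \<le> (int r - i) mod int n" "(int r - i) mod int n < int n" using assms by auto
  hence "x \<in> {i..j}" using assms(2) by (auto simp: x_def)
  moreover have "x = int r + (- ((int r - i) div int n)) * int n"
    by (simp add: x_def minus_div_mult_eq_mod[symmetric])
  hence "residue n x = r" by (simp only: residue_shift(1)[OF r])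
  ultimately show "r \<in> residue n ` {i..j}" by (metis imageI)
qed (use residue_decomp(1)[OF assms(1)] in auto)

section \<open>Crossings of the permutation of a rank set\<close>

context
  fixes n :: nat and M :: "nat set set"
  assumes M: "rank_set M" and le: "\<forall>S\<in>M. Max S \<le> n" and n: "n \<ge> 1"
begin

lemma Max_le_n: "S \<in> M \<Longrightarrow> Max S \<le> n"
  using le by blast

lemma rank_set_ends_n:
  "Min ` M \<subseteq> {1..n}" "Max ` M \<subseteq> {1..n}"
  "card ({1..n} - Min ` M) = n - card M" "card ({1..n} - Max ` M) = n - card M"
  by (rule rank_set_ends[OF M Max_le_n]; assumption)+

lemma rank_set_match_cases_n:
  assumes "r \<in> {1..n}"
  obtains (Max) S where "S \<in> M" "r = Max S" "rank_set_match n M r = Min S + n"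
  | (gap) i where "i < n - card M" "r = sorted_list_of_set ({1..n} - Max ` M) ! i"
      "rank_set_match n M r = sorted_list_of_set ({1..n} - Min ` M) ! i"
  by (rule rank_set_match_cases[OF M Max_le_n assms]) (assumption, erule (2) Max, erule (2) gap)

lemma rank_set_mem_eq: "S \<in> M \<Longrightarrow> S = {Min S..Max S}"
proof -
  assume "S \<in> M"
  then obtain a b where ab: "a \<le> b" "S = {a..b}" using M unfolding rank_set_def by blast
  have "Min {a..b} = a" "Max {a..b} = b" using ab(1) by (auto intro!: Min_eqI Max_eqI)
  thus ?thesis using ab(2) by simp
qed

lemma rank_set_mem_iff:
  assumes "S \<in> M"
  shows "S \<subseteq> {i..j} \<longleftrightarrow> i \<le> Min S \<and> Max S \<le> j"
    and "S \<inter> {i..j} \<noteq> {} \<longleftrightarrow> max (Min S) i \<le> min (Max S) j"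
    and "S \<subseteq> {1..n}" and "S \<noteq> {}"
proof -
  note mm = rank_set_interval[OF M assms] Max_le_n[OF assms]
  obtain a b where ab: "a = Min S" "b = Max S" "S = {a..b}" using rank_set_mem_eq[OF assms] by blast
  show "S \<subseteq> {i..j} \<longleftrightarrow> i \<le> Min S \<and> Max S \<le> j"
    unfolding ab(1,2)[symmetric] unfolding ab(3) using mm ab(1,2) by auto
  show "S \<inter> {i..j} \<noteq> {} \<longleftrightarrow> max (Min S) i \<le> min (Max S) j"
    unfolding ab(1,2)[symmetric] unfolding ab(3) Int_atLeastAtMost by auto
  show "S \<subseteq> {1..n}" unfolding ab(3) using mm ab(1,2) by auto
  show "S \<noteq> {}" unfolding ab(3) using mm ab(1,2) by auto
qed

lemma rank_set_perm_bounds: "x \<le> rank_set_perm n M x" "rank_set_perm n M x \<le> x + int n"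
  using rank_set_perm_Bound[OF M Max_le_n n] by (auto simp: Bound_def)

lemma rank_set_gap_nth:
  assumes "q < n - card M"
  shows "sorted_list_of_set ({1..n} - Max ` M) ! q \<in> {1..n} - Max ` M"
    and "sorted_list_of_set ({1..n} - Min ` M) ! q \<in> {1..n} - Min ` M"
proof -
  note ends = rank_set_ends_n
  have "sorted_list_of_set ({1..n} - Max ` M) ! q \<in> set (sorted_list_of_set ({1..n} - Max ` M))"
    "sorted_list_of_set ({1..n} - Min ` M) ! q \<in> set (sorted_list_of_set ({1..n} - Min ` M))"
    using assms ends(3,4) by (auto intro!: nth_mem simp del: set_sorted_list_of_set)
  thus "sorted_list_of_set ({1..n} - Max ` M) ! q \<in> {1..n} - Max ` M"
    "sorted_list_of_set ({1..n} - Min ` M) ! q \<in> {1..n} - Min ` M" by simp_all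
qed

text \<open>A crossing \<open>p\<close> has p \<le> t and value at least s + n, so boundedness puts
  it in \<open>{s..t}\<close>. Gaps have values at most \<open>n\<close>, so \<open>p\<close> is the
  right end of an interval, and its value shows that this interval starts at \<open>s\<close> or
  later.\<close>

lemma card_crossings_wrap:
  assumes st: "1 \<le> s" "s \<le> t" "t \<le> n"
  shows "card (crossings (int t + 1) (int s + int n - 1) (rank_set_perm n M))
    = card (intervals_in {s..t} M)"
proof -
  let ?f = "rank_set_perm n M"
  have "crossings (int t + 1) (int s + int n - 1) ?f = (\<lambda>S. int (Max S)) ` intervals_in {s..t} M"
  proof (intro equalityI subsetI)
    fix p assume "p \<in> crossings (int t + 1) (int s + int n - 1) ?f"
    hence p: "p \<le> int t" "?f p \<ge> int s + int n" by (auto simp: crossings_def)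
    have "p \<ge> int s" using rank_set_perm_bounds(2)[of p] p(2) by linarith
    then obtain r where r: "p = int r" "r \<in> {1..n}" using st p(1) by (cases p) auto
    have f: "?f p = int (rank_set_match n M r)" using rank_set_perm_shift[OF r(2), of M 0] r(1) by simp
    from r(2) show "p \<in> (\<lambda>S. int (Max S)) ` intervals_in {s..t} M"
    proof (cases rule: rank_set_match_cases_n)
      case (Max S)
      hence "s \<le> Min S" "Max S \<le> t" using p f r by auto
      thus ?thesis using Max r rank_set_mem_iff(1)[of S s t] by (auto simp: intervals_in_def)
    next
      case (gap q)
      thus ?thesis using rank_set_gap_nth(2)[of q] p f st by auto
    qed
  next
    fix p assume "p \<in> (\<lambda>S. int (Max S)) ` intervals_in {s..t} M"
    then obtain S where "S \<in> M" "S \<subseteq> {s..t}" "p = int (Max S)" by (auto simp: intervals_in_def)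
    thus "p \<in> crossings (int t + 1) (int s + int n - 1) ?f"
      using rank_set_perm_Max[OF M Max_le_n, of S] rank_set_mem_iff(1)[of S s t] by (auto simp: crossings_def)
  qed
  moreover have "inj_on (\<lambda>S. int (Max S)) (intervals_in {s..t} M)"
    using M by (auto simp: rank_set_def intervals_in_def inj_on_def)
  ultimately show ?thesis by (simp add: card_image)
qed

text \<open>Only the period \<open>{1..n}\<close> and the one before it contribute. In the earlier
  one, gaps have values at most 0 and right ends have value \<open>Min S\<close>. In
  \<open>{1..n}\<close>, right ends have values above \<open>n\<close>, hence above
  \<open>j\<close>, while a gap \<open>ds ! q\<close> has value \<open>cs ! q\<close>.\<close>

lemma crossings_straight:
  assumes ij: "1 \<le> i" "i \<le> j" "j \<le> n"
  defines "ds \<equiv> sorted_list_of_set ({1..n} - Max ` M)"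
    and "cs \<equiv> sorted_list_of_set ({1..n} - Min ` M)"
  shows "crossings (int i) (int j) (rank_set_perm n M)
    = (\<lambda>S. int (Max S) - int n) ` {S \<in> M. j < Min S} \<union> (\<lambda>S. int (Max S)) ` {S \<in> M. Max S < i}
      \<union> (\<lambda>q. int (ds ! q)) ` {q. q < n - card M \<and> ds ! q < i \<and> j < cs ! q}" (is "?C = ?A1 \<union> ?A2 \<union> ?A3")
proof (intro equalityI subsetI)
  let ?f = "rank_set_perm n M"
  fix p assume "p \<in> ?C"
  hence p: "p < int i" "?f p > int j" by (auto simp: crossings_def)
  define r q where "r = residue n p" and "q = (p - 1) div int n"
  have r: "r \<in> {1..n}" and pq: "p = int r + q * int n"
    using residue_decomp[OF n, of p] by (auto simp: r_def q_def)
  have f: "?f p = int (rank_set_match n M r) + q * int n" by (simp add: rank_set_perm_def r_def q_def)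
  have "q < 1"
  proof (rule ccontr)
    assume "\<not> q < 1"
    hence "1 * int n \<le> q * int n" by (intro mult_right_mono) auto
    moreover have "1 \<le> int r" "int i \<le> int n" using r ij by auto
    ultimately show False using pq p(1) by linarith
  qed
  \<comment> \<open>Two or more periods back, even the largest possible value \<open>r + n\<close>
    is shifted to at most 0.\<close>
  have "q > -2"
  proof (rule ccontr)
    assume "\<not> q > -2"
    hence "q * int n \<le> (-2) * int n" by (intro mult_right_mono) auto
    moreover have "rank_set_match n M r \<le> r + n" by (rule rank_set_match_bounds(2)[OF M Max_le_n r]; assumption)
    moreover have "int r \<le> int n" using r by simp
    ultimately show False using f p(2) by linarith
  qed
  with \<open>q < 1\<close> have q: "q = 0 \<or> q = -1" by linarith
  from r show "p \<in> ?A1 \<union> ?A2 \<union> ?A3"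
  proof (cases rule: rank_set_match_cases_n)
    case (Max S)
    from q show ?thesis
    proof
      assume "q = 0"
      hence "p \<in> ?A2" using Max pq p by auto
      thus ?thesis by blast
    next
      assume "q = -1"
      hence "p \<in> ?A1" using Max pq p f by auto
      thus ?thesis by blast
    qed
  next
    case (gap l)
    have "cs ! l \<le> n" using rank_set_gap_nth(2)[OF gap(1)] by (simp add: cs_def)
    hence "q = 0" using q f p gap by (auto simp: cs_def)
    hence "p \<in> ?A3" using gap pq p f by (auto simp: cs_def ds_def)
    thus ?thesis by blast
  qed
next
  let ?f = "rank_set_perm n M"
  fix p assume "p \<in> ?A1 \<union> ?A2 \<union> ?A3"
  then consider S where "S \<in> M" "j < Min S" "p = int (Max S) - int n"
    | S where "S \<in> M" "Max S < i" "p = int (Max S)"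
    | q where "q < n - card M" "ds ! q < i" "j < cs ! q" "p = int (ds ! q)" by auto
  thus "p \<in> ?C"
  proof cases
    case (1 S)
    have "?f p = int (Min S)"
      using rank_set_perm_translate[OF n, of M "int (Max S)" "-1"] rank_set_perm_Max[OF M Max_le_n 1(1)] 1(3)
      by simp
    thus ?thesis using 1 Max_le_n[of S] ij by (simp add: crossings_def)
  next
    case (2 S)
    thus ?thesis using rank_set_perm_Max[OF M Max_le_n 2(1)] ij rank_set_interval[OF M 2(1)]
      by (simp add: crossings_def)
  next
    case (3 q)
    thus ?thesis using rank_set_perm_gap[OF M Max_le_n 3(1)] by (simp add: crossings_def ds_def cs_def)
  qed
qed

text \<open>The three families of crossings are disjoint: the first has positions at most 0, the
  other two are right ends and gaps in \<open>{1..n}\<close>.\<close>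

lemma card_crossings_straight:
  assumes ij: "1 \<le> i" "i \<le> j" "j \<le> n"
  shows "card (crossings (int i) (int j) (rank_set_perm n M))
    = card {S \<in> M. j < Min S} + card {S \<in> M. Max S < i}
      + (card {d \<in> {1..n} - Max ` M. d < i} - card {c \<in> {1..n} - Min ` M. c \<le> j})"
proof -
  define D C where "D = {1..n} - Max ` M" and "C = {1..n} - Min ` M"
  define ds cs where "ds = sorted_list_of_set D" and "cs = sorted_list_of_set C"
  define Q where "Q = {q. q < n - card M \<and> ds ! q < i \<and> j < cs ! q}"
  let ?A1 = "(\<lambda>S. int (Max S) - int n) ` {S \<in> M. j < Min S}"
  let ?A2 = "(\<lambda>S. int (Max S)) ` {S \<in> M. Max S < i}"
  let ?A3 = "(\<lambda>q. int (ds ! q)) ` Q"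
  have fin: "finite M" "finite D" "finite C" "finite Q"
    using M by (auto simp: rank_set_def D_def C_def Q_def)
  have cards: "card D = n - card M" "card C = n - card M"
    using rank_set_ends_n by (simp_all add: D_def C_def)
  have ds: "ds ! q \<in> D" if "q \<in> Q" for q
    using rank_set_gap_nth(1)[of q] that by (simp add: Q_def ds_def D_def)
  have injMax: "inj_on Max M" using M by (simp add: rank_set_def)
  have "?A1 \<inter> (?A2 \<union> ?A3) = {}"
  proof -
    have "p \<le> 0" if "p \<in> ?A1" for p using that Max_le_n by auto
    moreover have "p > 0" if "p \<in> ?A2 \<union> ?A3" for p
      using that ds rank_set_interval[OF M] by (force simp: D_def)
    ultimately show ?thesis by (meson disjoint_iff not_le)
  qed
  moreover have "?A2 \<inter> ?A3 = {}" using ds by (force simp: D_def)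
  moreover have "crossings (int i) (int j) (rank_set_perm n M) = ?A1 \<union> (?A2 \<union> ?A3)"
    using crossings_straight[OF ij] by (simp add: ds_def cs_def D_def C_def Q_def Un_assoc)
  ultimately have "card (crossings (int i) (int j) (rank_set_perm n M)) = card ?A1 + (card ?A2 + card ?A3)"
    using fin by (simp add: card_Un_disjoint)
  moreover have "card ?A1 = card {S \<in> M. j < Min S}" "card ?A2 = card {S \<in> M. Max S < i}"
    using injMax by (auto intro!: card_image simp: inj_on_def)
  moreover have "card ?A3 = card Q"
  proof (rule card_image)
    have "inj_on ((!) ds) Q"
      unfolding ds_def using fin cards by (intro inj_on_nth) (auto simp: Q_def)
    thus "inj_on (\<lambda>q. int (ds ! q)) Q" by (simp add: inj_on_def)
  qed
  \<comment> \<open>Both gap lists are increasing, so the condition on \<open>ds\<close> bounds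
    \<open>q\<close> above and the one on \<open>cs\<close> bounds it below. An empty range agrees
    with truncated subtraction.\<close>
  moreover have "Q = {card {c \<in> C. c < Suc j}..<card {d \<in> D. d < i}}"
  proof -
    have "ds ! q < i \<longleftrightarrow> q < card {d \<in> D. d < i}" "j < cs ! q \<longleftrightarrow> card {c \<in> C. c < Suc j} \<le> q"
      if "q < n - card M" for q
      using nth_sorted_list_of_set_less_iff[OF fin(2), of q i]
        nth_sorted_list_of_set_less_iff[OF fin(3), of q "Suc j"] that cards
      by (simp_all add: ds_def cs_def less_Suc_eq_le) linarith
    moreover have "card {d \<in> D. d < i} \<le> n - card M"
      unfolding cards(1)[symmetric] using fin by (intro card_mono) auto
    ultimately show ?thesis by (auto simp: Q_def)
  qed
  ultimately show ?thesis by (simp add: D_def C_def less_Suc_eq_le)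
qed

text \<open>Every point of \<open>{1..x}\<close> is either a gap or an end of exactly one interval;
  applied with \<open>Min\<close> and \<open>Max\<close> for \<open>f\<close>.\<close>

lemma card_gaps_below:
  assumes "inj_on f M" "f ` M \<subseteq> {1..n}" "x \<le> n"
  shows "card {d \<in> {1..n} - f ` M. d \<le> x} + card {S \<in> M. f S \<le> x} = x"
proof -
  have fin: "finite M" using M by (simp add: rank_set_def)
  have "inj_on f {S \<in> M. f S \<le> x}" using assms(1) by (rule inj_on_subset) auto
  hence "card {S \<in> M. f S \<le> x} = card (f ` {S \<in> M. f S \<le> x})" by (simp add: card_image)
  moreover have un: "{1..x} = {d \<in> {1..n} - f ` M. d \<le> x} \<union> f ` {S \<in> M. f S \<le> x}"
    using assms(2,3) by auto
  have "card {1..x} = card {d \<in> {1..n} - f ` M. d \<le> x} + card (f ` {S \<in> M. f S \<le> x})"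
    unfolding un using fin by (intro card_Un_disjoint) auto
  ultimately show ?thesis by simp
qed

text \<open>Let A intervals end before \<open>i\<close>, B start after \<open>j\<close> and L meet
  \<open>{i..j}\<close>, so that k = A + B + L. The two gap counts are i - 1 - A and j - (A + L), so
  there are A + B + max 0 (L - (j - i + 1)) crossings. Subtracting this from k leaves min L (j - i +
  1).\<close>

lemma crossings_generic_rank_straight:
  assumes ij: "1 \<le> i" "i \<le> j" "j \<le> n"
  shows "int (card M) - int (card (crossings (int i) (int j) (rank_set_perm n M)))
    = int (generic_rank M {i..j})"
proof -
  have fin: "finite M" and inj: "inj_on Min M" "inj_on Max M" using M by (auto simp: rank_set_def)
  note ends = rank_set_ends_n
  have lt: "x < i \<longleftrightarrow> x \<le> i - 1" for x using ij by auto
  have below: "card {d \<in> {1..n} - Max ` M. d < i} + card {S \<in> M. Max S < i} = i - 1"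
    unfolding lt using card_gaps_below[OF inj(2) ends(2), of "i - 1"] ij by simp
  have upto: "card {c \<in> {1..n} - Min ` M. c \<le> j} + card {S \<in> M. Min S \<le> j} = j"
    using card_gaps_below[OF inj(1) ends(1) ij(3)] .
  have "M = {S \<in> M. Min S \<le> j} \<union> {S \<in> M. j < Min S}" by auto
  hence m1: "card M = card {S \<in> M. Min S \<le> j} + card {S \<in> M. j < Min S}"
    using fin card_Un_disjoint[of "{S \<in> M. Min S \<le> j}" "{S \<in> M. j < Min S}"] by fastforce
  have "S \<inter> {i..j} \<noteq> {} \<longleftrightarrow> Min S \<le> j \<and> i \<le> Max S" if "S \<in> M" for S
    using rank_set_mem_iff(2)[OF that, of i j] rank_set_interval[OF M that] ij by auto
  hence L: "{S \<in> M. S \<inter> {i..j} \<noteq> {}} = {S \<in> M. Min S \<le> j \<and> i \<le> Max S}" by blast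
  have meet: "{S \<in> M. S \<inter> {i..j} \<noteq> {}} \<union> {S \<in> M. Max S < i} = {S \<in> M. Min S \<le> j}"
    unfolding L using rank_set_interval[OF M] ij by force
  have "{S \<in> M. S \<inter> {i..j} \<noteq> {}} \<inter> {S \<in> M. Max S < i} = {}"
    unfolding L by auto
  hence m2: "card {S \<in> M. Min S \<le> j} = card {S \<in> M. S \<inter> {i..j} \<noteq> {}} + card {S \<in> M. Max S < i}"
    using fin meet card_Un_disjoint[of "{S \<in> M. S \<inter> {i..j} \<noteq> {}}" "{S \<in> M. Max S < i}"] by simp
  show ?thesis
    unfolding card_crossings_straight[OF ij] generic_rank_def using below upto m1 m2 ij by simp
qed

section \<open>Matchings between intervals and positions\<close>

lemma matching_straight:
  assumes ij: "1 \<le> i" "i \<le> j" "j \<le> n"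
  shows "\<exists>J m. J \<subseteq> M \<and> card J = generic_rank M {i..j} \<and> inj_on m J \<and> (\<forall>S\<in>J. m S \<in> S \<inter> {i..j})"
proof -
  let ?L = "{S \<in> M. S \<inter> {i..j} \<noteq> {}}"
  have "finite ?L" "inj_on Min ?L" "inj_on Max ?L"
    using M by (auto simp: rank_set_def inj_on_def)
  moreover have "Min S \<le> Max S \<and> Min S \<le> j \<and> i \<le> Max S" if "S \<in> ?L" for S
    using that rank_set_mem_iff(2)[of S i j] rank_set_interval[OF M, of S] by auto
  ultimately obtain J m where J: "J \<subseteq> ?L" "card J = min (card ?L) (Suc j - i)" "inj_on m J"
    "\<forall>S\<in>J. m S \<in> {Min S..Max S} \<inter> {i..j}"
    using interval_matching[of ?L Min Max j i] by blast
  have "m S \<in> S \<inter> {i..j}" if "S \<in> J" for S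
    using that J(1,4) rank_set_mem_eq[of S] by blast
  thus ?thesis using J by (intro exI[of _ J] exI[of _ m]) (auto simp: generic_rank_def)
qed

text \<open>An interval not inside \<open>{s..t}\<close> has an end in \<open>Y\<close>; taking the
  left end if it is below \<open>s\<close> and the right end otherwise is injective. Thus all
  intervals meeting \<open>Y\<close> are matched, and their number is the minimum in
  \<open>generic_rank\<close>.\<close>

lemma matching_wrap:
  assumes st: "1 \<le> s" "s \<le> t" "t \<le> n"
  defines "Y \<equiv> {1..n} - {s..t}"
  shows "card M - card (intervals_in {s..t} M) = generic_rank M Y"
    and "card (intervals_in {s..t} M) \<le> card M"
    and "\<exists>J m. J \<subseteq> M \<and> card J = generic_rank M Y \<and> inj_on m J \<and> (\<forall>S\<in>J. m S \<in> S \<inter> Y)"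
proof -
  let ?L = "{S \<in> M. S \<inter> Y \<noteq> {}}"
  have fin: "finite M" and inj: "inj_on Min M" "inj_on Max M" using M by (auto simp: rank_set_def)
  have L: "?L = M - intervals_in {s..t} M"
    using rank_set_mem_iff(3) by (fastforce simp: Y_def intervals_in_def)
  have sub: "intervals_in {s..t} M \<subseteq> M" by (auto simp: intervals_in_def)
  define m where "m S = (if Min S < s then Min S else Max S)" for S :: "nat set"
  have m: "m S \<in> S \<inter> Y \<and> (Min S < s \<or> t < Max S)" if "S \<in> ?L" for S
  proof -
    have S: "S \<in> M" "\<not> S \<subseteq> {s..t}" using that by (auto simp: Y_def)
    hence *: "Min S < s \<or> t < Max S" using rank_set_mem_iff(1)[of S s t] by auto
    note mm = rank_set_interval[OF M S(1)] Max_le_n[OF S(1)]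
    hence "Min S \<in> {Min S..Max S}" "Max S \<in> {Min S..Max S}" by auto
    hence "Min S \<in> S" "Max S \<in> S" using rank_set_mem_eq[OF S(1)] by blast+
    thus ?thesis using * mm st by (auto simp: m_def Y_def)
  qed
  have injm: "inj_on m ?L"
  proof (rule inj_onI)
    fix S T assume S: "S \<in> ?L" and T: "T \<in> ?L" and eq: "m S = m T"
    \<comment> \<open>Chosen points below \<open>s\<close> are left ends and those above
      \<open>t\<close> are right ends, so equal points are ends of the same kind.\<close>
    have "Min S = Min T \<or> Max S = Max T" using eq m[OF S] m[OF T] st by (auto simp: m_def split: if_splits)
    thus "S = T" using S T inj by (auto dest: inj_onD)
  qed
  have "card ?L = card (m ` ?L)" using injm by (simp add: card_image)
  also have "\<dots> \<le> card Y" using m by (intro card_mono) (simp add: Y_def, blast)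
  finally have rk: "generic_rank M Y = card ?L" by (simp add: generic_rank_def)
  show "card M - card (intervals_in {s..t} M) = generic_rank M Y"
    using fin sub by (simp add: rk L card_Diff_subset finite_subset)
  show "card (intervals_in {s..t} M) \<le> card M" using fin sub by (rule card_mono)
  show "\<exists>J m. J \<subseteq> M \<and> card J = generic_rank M Y \<and> inj_on m J \<and> (\<forall>S\<in>J. m S \<in> S \<inter> Y)"
    using injm m rk by (intro exI[of _ ?L] exI[of _ m]) auto
qed

text \<open>A shift by a multiple of \<open>n\<close> puts the left end into \<open>{1..n}\<close>.
  The interval then stays within \<open>{1..n}\<close>, or passes \<open>n\<close> and misses
  exactly the residues \<open>{s..t}\<close>, or has at least \<open>n\<close> members. In the last
  case it covers all residues and boundedness leaves no crossings, as for
  \<open>{1..n}\<close>.\<close>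

lemma cyclic_interval_cases:
  assumes "i \<le> j"
  obtains (straight) i' j' where "1 \<le> i'" "i' \<le> j'" "j' \<le> n" "residue n ` {i..j} = {i'..j'}"
      "card (crossings i j (rank_set_perm n M)) = card (crossings (int i') (int j') (rank_set_perm n M))"
  | (wrap) s t where "1 \<le> s" "s \<le> t" "t \<le> n" "residue n ` {i..j} = {1..n} - {s..t}"
      "card (crossings i j (rank_set_perm n M))
        = card (crossings (int t + 1) (int s + int n - 1) (rank_set_perm n M))"
proof -
  define r q where "r = residue n i" and "q = (i - 1) div int n"
  have r: "r \<in> {1..n}" and i: "i = int r + q * int n"
    using residue_decomp[OF n, of i] by (auto simp: r_def q_def)
  define l where "l = j - q * int n"
  have j: "j = l + q * int n" by (simp add: l_def)
  have rl: "int r \<le> l" using assms i j by simp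
  have Y: "residue n ` {i..j} = residue n ` {int r..l}"
    unfolding i j by (rule residue_image_translate[OF n])
  have C: "card (crossings i j (rank_set_perm n M)) = card (crossings (int r) l (rank_set_perm n M))"
    unfolding i j by (rule card_crossings_translate[OF n])
  consider "l \<le> int n" | "int n < l" "l < int r + int n - 1" | "int r + int n - 1 \<le> l" by linarith
  thus thesis
  proof cases
    case 1
    obtain l' where l': "l = int l'" using rl by (metis int_nat_eq of_nat_0_le_iff order_trans)
    show thesis
      by (rule straight[of r l']) (use r 1 l' rl Y C residue_image_straight[of r l' n] in auto)
  next
    case 2
    define s t where "s = nat (l + 1 - int n)" and "t = r - 1"
    have st: "1 \<le> s" "s \<le> t" "t \<le> n" "int r = int t + 1" "l = int s + int n - 1"
      using 2 r by (auto simp: s_def t_def)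
    show thesis by (rule wrap[of s t]) (use st Y C residue_image_wrap[of s t n] in auto)
  next
    case 3
    have empty: "crossings i' j' (rank_set_perm n M) = {}" if "i' + int n - 1 \<le> j'" for i' j'
    proof -
      have "\<not> j' < rank_set_perm n M p" if "p < i'" for p
        using rank_set_perm_bounds(2)[of p] that \<open>i' + int n - 1 \<le> j'\<close> by linarith
      thus ?thesis by (auto simp: crossings_def)
    qed
    show thesis
      by (rule straight[of 1 n]) (use n 3 Y C empty residue_image_full[OF n 3] in auto)
  qed
qed

lemma crossings_generic_rank:
  assumes "i \<le> j"
  shows "int (card M) - int (card (crossings i j (rank_set_perm n M)))
    = int (generic_rank M (residue n ` {i..j}))"
  using assms
proof (cases rule: cyclic_interval_cases)
  case (straight i' j')
  thus ?thesis using crossings_generic_rank_straight[of i' j'] by simp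
next
  case (wrap s t)
  thus ?thesis using card_crossings_wrap[of s t] matching_wrap[of s t] by simp
qed

lemma cyclic_matching:
  assumes "i \<le> j"
  shows "\<exists>J m. J \<subseteq> M \<and> card J = generic_rank M (residue n ` {i..j}) \<and> inj_on m J
    \<and> (\<forall>S\<in>J. m S \<in> S \<inter> residue n ` {i..j})"
  using assms
proof (cases rule: cyclic_interval_cases)
  case (straight i' j')
  thus ?thesis using matching_straight[of i' j'] by simp
next
  case (wrap s t)
  thus ?thesis using matching_wrap(3)[of s t] by simp
qed

end

section \<open>Adapted families of vectors\<close>

lemma hom_poly_continuous:
  fixes x :: "'b::topological_space \<Rightarrow> 'i \<Rightarrow> complex"
  assumes "hom_poly X d F" "\<And>i. i \<in> X \<Longrightarrow> continuous_on A (\<lambda>t. x t i)"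
  shows "continuous_on A (\<lambda>t. F (x t))"
  using assms by induction (auto intro!: continuous_intros)

text \<open>The exceptional set is open and finite, and a nonempty finite set is not open in a
  Euclidean space.\<close>

lemma continuous_zero_if_cofinitely_zero:
  fixes g :: "'a::euclidean_space \<Rightarrow> 'b::t2_space"
  assumes g: "continuous_on UNIV g" and fin: "finite {t. g t \<noteq> c}"
  shows "g t = c"
proof -
  have "open {t. g t \<noteq> c}" using g by (intro open_Collect_neq continuous_on_const)
  hence "{t. g t \<noteq> c} = {}" using fin finite_imp_not_open by blast
  thus ?thesis by blast
qed

context
  fixes e :: "nat \<Rightarrow> complex^'n"
  assumes e: "coord_basis e"
begin

text \<open>The matrix entries are affine in t and the determinant is a polynomial in them.\<close>

lemma continuous_plucker_segment:
  "continuous_on UNIV (\<lambda>t. plucker e k (\<lambda>r. x r + t *s y r) I)"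
proof -
  have "continuous_on UNIV (\<lambda>t. mat k k (\<lambda>(r, c). coord e (x r + t *s y r) (sorted_list_of_set I ! c)) $$ (i, p i))"
    if "p permutes {0..<k}" "i \<in> {0..<k}" for p i
  proof -
    have "p i \<in> {0..<k}" using permutes_in_image[OF that(1)] that(2) by blast
    thus ?thesis using that(2)
      by (simp add: coord_add[OF e] coord_scale[OF e]) (intro continuous_intros)
  qed
  thus ?thesis unfolding plucker_def Determinant.det_def
    by (simp del: index_mat) (intro continuous_on_sum continuous_on_mult continuous_on_const continuous_on_prod; auto)
qed

text \<open>A vector of \<langle>S\<rangle> projects to 0 when S is disjoint from \<open>Y\<close>,
  so only the intervals meeting \<open>Y\<close> contribute generators; the target has dimension at
  most the size of \<open>Y\<close>.\<close>

lemma dim_coord_proj_span_le: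
  assumes M: "finite M" "\<And>S. S \<in> M \<Longrightarrow> S \<subseteq> {1..CARD('n)}" and Y: "Y \<subseteq> {1..CARD('n)}"
    and u: "\<And>S. S \<in> M \<Longrightarrow> u S \<in> coord_span e S"
  shows "vec.dim (coord_proj e Y ` vec.span (u ` M)) \<le> generic_rank M Y"
proof -
  let ?L = "{S \<in> M. S \<inter> Y \<noteq> {}}"
  have "coord_proj e Y ` u ` M \<subseteq> vec.span ((\<lambda>S. coord_proj e Y (u S)) ` ?L)"
  proof clarify
    fix S assume S: "S \<in> M"
    show "coord_proj e Y (u S) \<in> vec.span ((\<lambda>S. coord_proj e Y (u S)) ` ?L)"
    proof (cases "S \<inter> Y = {}")
      case True
      hence "coord_span e S \<subseteq> coord_span e ({1..CARD('n)} - Y)"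
        unfolding coord_span_def using M(2)[OF S] by (intro vec.span_mono) auto
      hence "coord_proj e Y (u S) = 0" using u[OF S] coord_proj_eq_0_iff[OF e] by blast
      thus ?thesis by (simp add: vec.span_zero)
    next
      case False
      thus ?thesis using S by (intro vec.span_base) auto
    qed
  qed
  hence "vec.dim (coord_proj e Y ` u ` M) \<le> card ((\<lambda>S. coord_proj e Y (u S)) ` ?L)"
    using M(1) by (intro vec.dim_le_card) auto
  also have "\<dots> \<le> card ?L" using M(1) by (intro card_image_le) auto
  finally have "vec.dim (coord_proj e Y ` vec.span (u ` M)) \<le> card ?L"
    by (simp add: vec.linear_span_image[OF linear_coord_proj[OF e], symmetric] vec.dim_span)
  moreover have "vec.dim (coord_proj e Y ` vec.span (u ` M)) \<le> card Y"
    using Y finite_subset by (intro dim_coord_proj_image_le[OF e]) auto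
  ultimately show ?thesis by (simp add: generic_rank_def)
qed

text \<open>Sets \<open>Y\<close> are added one at a time. A family \<open>w\<close> good for the
  earlier sets and a family \<open>x\<close> good for the new one are joined by a segment, on which
  all but finitely many points are good for all of them.\<close>

lemma generic_adapted_family:
  fixes M :: "nat set set"
  assumes M: "finite M" and \<Y>: "finite \<Y>" "\<And>Y. Y \<in> \<Y> \<Longrightarrow> Y \<subseteq> {1..CARD('n)}"
    and match: "\<And>Y. Y \<in> \<Y> \<Longrightarrow> \<exists>J m. J \<subseteq> M \<and> card J = r Y \<and> inj_on m J \<and> (\<forall>S\<in>J. m S \<in> S \<inter> Y)"
  shows "\<exists>w. (\<forall>S\<in>M. w S \<in> coord_span e S) \<and> (\<forall>Y\<in>\<Y>. r Y \<le> vec.dim (coord_proj e Y ` w ` M))"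
  using \<Y> match
proof (induction rule: finite_induct)
  case empty
  show ?case by (intro exI[of _ "\<lambda>_. 0"]) (simp add: coord_span_def vec.span_zero)
next
  case (insert Y \<Y>)
  then obtain w where w: "\<And>S. S \<in> M \<Longrightarrow> w S \<in> coord_span e S"
    "\<And>Z. Z \<in> \<Y> \<Longrightarrow> r Z \<le> vec.dim (coord_proj e Z ` w ` M)" by (metis insertCI)
  obtain J m where J: "J \<subseteq> M" "card J = r Y" "inj_on m J" "\<And>S. S \<in> J \<Longrightarrow> m S \<in> S \<inter> Y"
    using insert.prems(2)[of Y] by auto
  \<comment> \<open>Matched intervals receive the basis vector of their position, which the
    projection to \<open>Y\<close> fixes. The others receive 0, which lies in every coordinate
    subspace.\<close>
  define x where "x S = (if S \<in> J then e (m S) else 0)" for S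
  have x: "x S \<in> coord_span e S" for S
    using J(4) by (auto simp: x_def coord_span_def vec.span_zero intro!: vec.span_base)
  have mJ: "m ` J \<subseteq> {1..CARD('n)}" using J(4) insert.prems(1)[of Y] by blast
  have "coord_proj e Y (x S) = e (m S)" if "S \<in> J" for S
    using that J(4)[OF that] mJ by (simp add: x_def) (intro coord_proj_basis_vector[OF e], auto)
  hence "e ` m ` J \<subseteq> coord_proj e Y ` x ` M" using J(1) by (force simp: image_iff)
  moreover have "vec.independent (e ` m ` J)"
    using e mJ unfolding coord_basis_def by (meson image_mono vec.independent_mono)
  ultimately have "card (e ` m ` J) \<le> vec.dim (coord_proj e Y ` x ` M)"
    by (rule vec.independent_card_le_dim)
  moreover have "card (e ` m ` J) = r Y"
    using e mJ J(2,3) by (metis card_image coord_basis_def inj_on_subset)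
  ultimately have xY: "r Y \<le> vec.dim (coord_proj e Y ` x ` M)" by simp
  define z where "z t S = (1 - t) *s w S + t *s x S" for t S
  have proj: "coord_proj e Z ` z t ` M
    = (\<lambda>S. (1 - t) *s coord_proj e Z (w S) + t *s coord_proj e Z (x S)) ` M" for t Z
    by (simp add: z_def image_image vec.linear_add[OF linear_coord_proj[OF e]]
        vec.linear_scale[OF linear_coord_proj[OF e]])
  let ?bad = "\<lambda>Z. {t. vec.dim (coord_proj e Z ` z t ` M)
    < max (vec.dim (coord_proj e Z ` w ` M)) (vec.dim (coord_proj e Z ` x ` M))}"
  have "finite (?bad Z)" for Z
    using finite_dim_segment_drop[OF M, of "\<lambda>S. coord_proj e Z (w S)" "\<lambda>S. coord_proj e Z (x S)"]
    unfolding proj by (simp add: image_image)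
  hence "finite (\<Union>Z\<in>insert Y \<Y>. ?bad Z)" using insert.hyps(1) by simp
  then obtain t where t: "t \<notin> (\<Union>Z\<in>insert Y \<Y>. ?bad Z)"
    using ex_new_if_finite[OF infinite_UNIV_char_0] by blast
  have "r Z \<le> vec.dim (coord_proj e Z ` z t ` M)" if Z: "Z \<in> insert Y \<Y>" for Z
  proof -
    have "max (vec.dim (coord_proj e Z ` w ` M)) (vec.dim (coord_proj e Z ` x ` M))
      \<le> vec.dim (coord_proj e Z ` z t ` M)" using t Z by (auto simp: not_less)
    thus ?thesis using Z xY w(2)[of Z] by auto
  qed
  moreover have "z t S \<in> coord_span e S" if "S \<in> M" for S
    unfolding z_def using w(1)[OF that] x[of S]
    unfolding coord_span_def by (intro vec.span_add vec.span_scale)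
  ultimately show ?case by blast
qed

end

lemma card_ge_1: "CARD('n::finite) \<ge> 1"
  using zero_less_card_finite[where 'a='n] by linarith

section \<open>Bases adapted to a rank set\<close>

context
  fixes e :: "nat \<Rightarrow> complex^'n" and M :: "nat set set"
  assumes e: "coord_basis e" and M: "rank_set M" and le: "\<forall>S\<in>M. Max S \<le> CARD('n)"
begin


text \<open>Intervals are added by increasing right end, each with a vector of V \<inter>
  \<langle>S0\<rangle> outside the span of the earlier vectors. If there were none, this space would
  be spanned by the vectors of the intervals properly inside \<open>S0\<close>, which are too few
  for the rank condition.\<close>

lemma adapted_basis_exists:
  assumes V: "vec.subspace V"
    and dim: "\<And>S T. S \<in> M \<Longrightarrow> T \<in> M \<Longrightarrow>
      vec.dim (V \<inter> coord_span e (S \<inter> T)) = card (intervals_in (S \<inter> T) M)"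
  shows "\<exists>u. (\<forall>S\<in>M. u S \<in> V \<inter> coord_span e S) \<and> inj_on u M \<and> vec.independent (u ` M)"
proof -
  have fin: "finite M" and inj: "inj_on Min M" "inj_on Max M" using M by (auto simp: rank_set_def)
  have mem: "S = {Min S..Max S}" "1 \<le> Min S" "Min S \<le> Max S" "S \<subseteq> {1..CARD('n)}" if "S \<in> M" for S
    by (rule rank_set_mem_eq[OF M le card_ge_1 that] rank_set_interval[OF M that]
        rank_set_mem_iff(3)[OF M le card_ge_1 that])+
  have sub: "vec.subspace (coord_span e X)" for X unfolding coord_span_def by (rule vec.subspace_span)
  have "\<exists>u. (\<forall>S\<in>{S \<in> M. Max S \<le> b}. u S \<in> V \<inter> coord_span e S) \<and> inj_on u {S \<in> M. Max S \<le> b}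
    \<and> vec.independent (u ` {S \<in> M. Max S \<le> b})" for b
  proof (induction b)
    case 0
    have empty: "{S \<in> M. Max S \<le> 0} = {}" using mem by fastforce
    show ?case unfolding empty by (simp add: vec.independent_empty)
  next
    case (Suc b)
    define N where "N = {S \<in> M. Max S \<le> b}"
    from Suc obtain u where u: "\<And>S. S \<in> N \<Longrightarrow> u S \<in> V \<inter> coord_span e S" "inj_on u N"
      "vec.independent (u ` N)" unfolding N_def by blast
    have finN: "finite N" using fin by (simp add: N_def)
    show ?case
    proof (cases "\<exists>S\<in>M. Max S = Suc b")
      case False
      hence "{S \<in> M. Max S \<le> Suc b} = N" unfolding N_def using le_Suc_eq by blast
      thus ?thesis using u by auto
    next
      case True
      then obtain S0 where S0: "S0 \<in> M" "Max S0 = Suc b" by blast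
      have uniq: "S = S0" if "S \<in> M" "Max S = Suc b \<or> Min S = Min S0" for S
        using that S0 inj by (metis inj_onD)
      have ins: "{S \<in> M. Max S \<le> Suc b} = insert S0 N"
        using S0 uniq by (auto simp only: N_def le_Suc_eq)
      have S0N: "S0 \<notin> N" using S0 by (simp add: N_def)
      \<comment> \<open>Earlier intervals end before \<open>S0\<close>, so those that start after it
        are exactly the members of \<open>M\<close> properly inside \<open>S0\<close>.\<close>
      define P where "P = {S \<in> N. Min S0 < Min S}"
      have sub0: "S \<subseteq> S0 \<longleftrightarrow> Min S0 \<le> Min S \<and> Max S \<le> Max S0" if "S \<in> M" for S
        using rank_set_mem_iff(1)[OF M le card_ge_1 that, of "Min S0" "Max S0"] mem(1)[OF S0(1)] by simp
      have neq: "Min S < Min S0 \<or> Min S0 < Min S" if "S \<in> N" for S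
      proof -
        have "Min S \<noteq> Min S0" using that uniq[of S] S0N by (auto simp: N_def)
        thus ?thesis by linarith
      qed
      have inS0: "intervals_in (S0 \<inter> S0) M = insert S0 P"
      proof -
        have "S \<subseteq> S0 \<longleftrightarrow> S = S0 \<or> S \<in> P" if "S \<in> M" for S
        proof (cases "S = S0")
          case False
          hence "Max S \<noteq> Suc b" "Min S \<noteq> Min S0" using uniq[OF that] by auto
          thus ?thesis unfolding sub0[OF that] using that False S0 by (simp add: P_def N_def) linarith
        qed simp
        thus ?thesis using S0(1) by (auto simp: intervals_in_def P_def N_def)
      qed
      have "\<not> V \<inter> coord_span e S0 \<subseteq> vec.span (u ` N)"
      proof
        assume *: "V \<inter> coord_span e S0 \<subseteq> vec.span (u ` N)"
        have "V \<inter> coord_span e S0 \<subseteq> vec.span (u ` P)"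
        proof
          fix w assume w: "w \<in> V \<inter> coord_span e S0"
          with * obtain c where "w = (\<Sum>x\<in>u ` N. c x *s x)"
            using vec.span_finite[of "u ` N"] finN by auto
          hence wsum: "w = (\<Sum>S\<in>N. c (u S) *s u S)" using u(2) by (simp add: sum.reindex)
          \<comment> \<open>The part \<open>z\<close> of \<open>w\<close> from intervals starting left of \<open>S0\<close> lies in
            \<open>V \<inter> \<langle>S0 \<inter> S1\<rangle>\<close> for one of them, \<open>S1\<close>; by the rank condition for \<open>S0\<close> and \<open>S1\<close>
            it is a combination of the vectors for intervals inside \<open>S0\<close>.\<close>
          define R where "R = {S \<in> N. Min S < Min S0}"
          define z where "z = (\<Sum>S\<in>R. c (u S) *s u S)"
          define y where "y = (\<Sum>S\<in>P. c (u S) *s u S)"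
          have RP: "N = R \<union> P" "R \<inter> P = {}" using neq by (auto simp: R_def P_def)
          have "finite R" "finite P" using finN by (auto simp: R_def P_def)
          hence wzy: "w = z + y"
            unfolding wsum z_def y_def unfolding RP(1) using RP(2) by (rule sum.union_disjoint)
          have yP: "y \<in> vec.span (u ` P)"
            unfolding y_def by (intro vec.span_sum vec.span_scale vec.span_base) auto
          have "u S \<in> V \<inter> coord_span e S0" if "S \<in> P" for S
          proof -
            have "S \<subseteq> S0" using that inS0 by (auto simp: intervals_in_def)
            hence "coord_span e S \<subseteq> coord_span e S0" unfolding coord_span_def by (intro vec.span_mono) auto
            thus ?thesis using u(1)[of S] that by (auto simp: P_def)
          qed
          hence "y \<in> V \<inter> coord_span e S0"
            unfolding y_def using V sub by (intro vec.subspace_sum vec.subspace_inter vec.subspace_scale) auto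
          hence z: "z \<in> V \<inter> coord_span e S0"
            using w wzy vec.subspace_diff[OF vec.subspace_inter[OF V sub], of w S0 y] by simp
          have "z \<in> vec.span (u ` P)"
          proof (cases "\<exists>S\<in>R. c (u S) \<noteq> 0")
            case False
            hence "z = 0" by (simp add: z_def)
            thus ?thesis by (simp add: vec.span_zero)
          next
            case True
            \<comment> \<open>Only nonzero coefficients matter. \<open>S1\<close> is the interval
              among these with the largest right end, so \<open>z\<close> has no coordinates beyond
              \<open>Max S1\<close>.\<close>
            define R' where "R' = {S \<in> R. c (u S) \<noteq> 0}"
            have "finite R'" "R' \<noteq> {}" using True finN by (auto simp: R'_def R_def)
            hence "Max (Max ` R') \<in> Max ` R'" by (intro Max_in) auto
            then obtain S1 where S1: "S1 \<in> R'" "Max S1 = Max (Max ` R')" by auto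
            have S1_max: "Max S \<le> Max S1" if "S \<in> R'" for S
              unfolding S1(2) using that \<open>finite R'\<close> by (intro Max_ge) auto
            have S1M: "S1 \<in> M" "Min S1 < Min S0" "Max S1 < Max S0"
              using S1(1) S0(2) by (auto simp: R'_def R_def N_def)
            have "c (u S) *s u S \<in> coord_span e {1..Max S1}" if "S \<in> R" for S
            proof (cases "S \<in> R'")
              case True
              have "S \<in> M" "S \<in> N" using that by (auto simp: R_def N_def)
              hence "S \<subseteq> {1..Max S1}" using rank_set_mem_iff(1)[OF M le card_ge_1, of S 1 "Max S1"] S1_max[OF True] mem(2) by simp
              hence "coord_span e S \<subseteq> coord_span e {1..Max S1}"
                unfolding coord_span_def by (intro vec.span_mono) auto
              thus ?thesis using u(1)[OF \<open>S \<in> N\<close>] sub by (auto intro!: vec.subspace_scale)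
            next
              case False
              thus ?thesis using that sub by (simp add: R'_def vec.subspace_0)
            qed
            hence "z \<in> coord_span e {1..Max S1}"
              unfolding z_def using sub by (intro vec.subspace_sum) auto
            moreover have "{1..Max S1} \<subseteq> {1..CARD('n)}" using le S1M(1) by auto
            ultimately have "z \<in> coord_span e (S0 \<inter> {1..Max S1})"
              using z coord_span_Int[OF e mem(4)[OF S0(1)]] by blast
            \<comment> \<open>\<open>S1\<close> starts before \<open>S0\<close>, so cutting
              \<open>S0\<close> at \<open>Max S1\<close> is the same as intersecting with
              \<open>S1\<close>.\<close>
            moreover have S01: "S0 \<inter> {1..Max S1} = S0 \<inter> S1"
            proof -
              have "{Min S0..Max S0} \<inter> {1..Max S1} = {Min S0..Max S0} \<inter> {Min S1..Max S1}"
                using S1M mem(2)[OF S0(1)] by auto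
              thus ?thesis using mem(1)[OF S0(1)] mem(1)[OF S1M(1)] by simp
            qed
            ultimately have zV: "z \<in> V \<inter> coord_span e (S0 \<inter> S1)" using z by simp
            let ?Q = "intervals_in (S0 \<inter> S1) M"
            have "?Q \<subseteq> intervals_in (S0 \<inter> S0) M" by (auto simp: intervals_in_def)
            moreover have "S0 \<notin> ?Q"
            proof
              assume "S0 \<in> ?Q"
              hence "S0 \<subseteq> {1..Max S1}" using S01 by (auto simp: intervals_in_def)
              thus False using rank_set_mem_iff(1)[OF M le card_ge_1 S0(1)] S1M by force
            qed
            ultimately have QP: "?Q \<subseteq> P" unfolding inS0 by blast
            hence QN: "?Q \<subseteq> N" by (auto simp: P_def)
            have "u ` ?Q \<subseteq> V \<inter> coord_span e (S0 \<inter> S1)"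
            proof
              fix x assume "x \<in> u ` ?Q"
              then obtain S where S: "S \<in> ?Q" "x = u S" by blast
              hence "coord_span e S \<subseteq> coord_span e (S0 \<inter> S1)"
                unfolding coord_span_def by (intro vec.span_mono) (auto simp: intervals_in_def)
              thus "x \<in> V \<inter> coord_span e (S0 \<inter> S1)" using u(1)[of S] S QN by auto
            qed
            moreover have "vec.independent (u ` ?Q)"
              using u(3) QN by (meson image_mono vec.independent_mono)
            moreover have "card (u ` ?Q) = card ?Q" using u(2) QN by (meson card_image inj_on_subset)
            \<comment> \<open>The independent vectors from \<open>?Q\<close> are as many as the
              prescribed dimension, so they span the whole intersection.\<close>
            ultimately have "V \<inter> coord_span e (S0 \<inter> S1) \<subseteq> vec.span (u ` ?Q)"
              using dim[OF S0(1) S1M(1)] by (intro vec.card_ge_dim_independent) auto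
            also have "\<dots> \<subseteq> vec.span (u ` P)" using QP by (intro vec.span_mono) auto
            finally show ?thesis using zV by blast
          qed
          thus "w \<in> vec.span (u ` P)" unfolding wzy using yP by (rule vec.span_add)
        qed
        moreover have finP: "finite P" using finN by (simp add: P_def)
        \<comment> \<open>The rank condition for \<open>S0\<close> with itself demands
          \<open>card P + 1\<close>, one more than this bound.\<close>
        ultimately have "vec.dim (V \<inter> coord_span e (S0 \<inter> S0)) \<le> card (u ` P)"
          by (intro vec.dim_le_card) auto
        also have "\<dots> \<le> card P" using finP by (rule card_image_le)
        finally show False using dim[OF S0(1) S0(1)] inS0 S0N finP by (simp add: P_def)
      qed
      then obtain w where w: "w \<in> V \<inter> coord_span e S0" "w \<notin> vec.span (u ` N)" by blast
      have im: "u(S0 := w) ` insert S0 N = insert w (u ` N)" using S0N by auto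
      have "w \<notin> u ` N" using w(2) vec.span_base by blast
      hence "inj_on (u(S0 := w)) (insert S0 N)" using S0N u(2) by (auto simp: inj_on_def)
      moreover have "vec.independent (u(S0 := w) ` insert S0 N)"
        unfolding im using w(2) u(3) by (rule vec.independent_insertI)
      moreover have "\<forall>S\<in>insert S0 N. (u(S0 := w)) S \<in> V \<inter> coord_span e S" using u(1) w(1) S0N by auto
      ultimately show ?thesis unfolding ins by blast
    qed
  qed
  moreover have "{S \<in> M. Max S \<le> CARD('n)} = M" using le by blast
  ultimately show ?thesis by metis
qed


text \<open>The open set whose closure is the positroid variety, with \<open>k - #[i,j](f\<^sub>M)\<close> replaced by its
  value.\<close>

definition positroid_stratum :: "(complex^'n) set set" where
  "positroid_stratum = {V \<in> Gr (card M). \<forall>i j. i \<le> j \<longrightarrow>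
     vec.dim (coord_proj e (residue CARD('n) ` {i..j}) ` V) = generic_rank M (residue CARD('n) ` {i..j})}"

definition rank_stratum :: "(complex^'n) set set" where
  "rank_stratum = {V \<in> Gr (card M). \<forall>S\<in>M. \<forall>T\<in>M.
     vec.dim (V \<inter> coord_span e (S \<inter> T)) = card (intervals_in (S \<inter> T) M)}"

section \<open>Comparison of the two strata and their closures\<close>

lemma positroid_variety_eq:
  "positroid_variety e (card M) (rank_set_perm CARD('n) M) = zariski_closure e (card M) positroid_stratum"
  by (simp add: positroid_variety_def positroid_stratum_def crossings_generic_rank[OF M le card_ge_1])

text \<open>The complement of S \<inter> T = \<open>{s..t}\<close> is a cyclic interval, so the
  prescribed projection rank there fixes the dimension of V \<inter> \<langle>S \<inter> T\<rangle>
  by rank-nullity.\<close>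

lemma positroid_stratum_subset_rank_stratum: "positroid_stratum \<subseteq> rank_stratum"
proof
  fix V assume V: "V \<in> positroid_stratum"
  hence sub: "vec.subspace V" and dimV: "vec.dim V = card M" by (auto simp: positroid_stratum_def Gr_def)
  have "vec.dim (V \<inter> coord_span e (S \<inter> T)) = card (intervals_in (S \<inter> T) M)" if S: "S \<in> M" and T: "T \<in> M" for S T
  proof -
    define s t where "s = max (Min S) (Min T)" and "t = min (Max S) (Max T)"
    have "{Min S..Max S} \<inter> {Min T..Max T} = {s..t}" by (simp add: s_def t_def)
    hence ST: "S \<inter> T = {s..t}"
      using rank_set_mem_eq[OF M le card_ge_1 S] rank_set_mem_eq[OF M le card_ge_1 T] by simp
    have st: "1 \<le> s" "t \<le> CARD('n)" using rank_set_interval[OF M S] S le by (auto simp: s_def t_def)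
    \<comment> \<open>The inequality in the second case says that the complementary cyclic interval
      is nonempty; it fails only for \<open>{s..t}\<close> equal to
      \<open>{1..CARD('n)}\<close>.\<close>
    consider "t < s" | "s \<le> t" "int t + 1 \<le> int s + int CARD('n) - 1" | "s = 1" "t = CARD('n)"
      using st by linarith
    thus ?thesis
    proof cases
      case 1
      hence "S \<inter> T = {}" using ST by simp
      moreover have "intervals_in {} M = {}"
        using rank_set_mem_iff(4)[OF M le card_ge_1] by (auto simp: intervals_in_def)
      ultimately show ?thesis by (simp add: coord_span_def vec.dim_eq_0)
    next
      case 2
      define Y where "Y = {1..CARD('n)} - {s..t}"
      have "vec.dim (coord_proj e Y ` V) = generic_rank M Y"
        using V 2 unfolding positroid_stratum_def Y_def residue_image_wrap[OF st(1) 2(1) st(2), symmetric] by blast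
      moreover have "{1..CARD('n)} - Y = {s..t}" using st by (auto simp: Y_def)
      ultimately show ?thesis
        using dim_coord_proj_plus_dim_Int[OF e sub, of Y] dimV
          matching_wrap(1,2)[OF M le card_ge_1 st(1) 2(1) st(2)]
        unfolding ST Y_def by simp
    next
      case 3
      hence "coord_span e (S \<inter> T) = UNIV" using e ST by (simp add: coord_span_def coord_basis_def)
      moreover have "intervals_in (S \<inter> T) M = M"
        using rank_set_mem_iff(3)[OF M le card_ge_1] 3 ST by (auto simp: intervals_in_def)
      ultimately show ?thesis using dimV by simp
    qed
  qed
  thus "V \<in> rank_stratum" using V by (auto simp: rank_stratum_def positroid_stratum_def)
qed

text \<open>The linear maps \<open>g t\<close> move any chosen basis of \<open>V\<close> along with \<open>V\<close>, so the Pluecker vectors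
  of different bases need not be compared.\<close>

lemma rank_stratum_subset_closed:
  assumes Z: "zariski_closed e (card M) Z" "positroid_stratum \<subseteq> Z"
  shows "rank_stratum \<subseteq> Z"
proof
  fix V assume V: "V \<in> rank_stratum"
  hence VGr: "V \<in> Gr (card M)" and sub: "vec.subspace V" and dimV: "vec.dim V = card M"
    by (auto simp: rank_stratum_def Gr_def)
  have fin: "finite M" using M by (simp add: rank_set_def)
  obtain u where u: "\<And>S. S \<in> M \<Longrightarrow> u S \<in> V \<inter> coord_span e S" "inj_on u M" "vec.independent (u ` M)"
    using adapted_basis_exists[OF sub] V unfolding rank_stratum_def by blast
  have spanV: "vec.span (u ` M) = V"
  proof
    show "vec.span (u ` M) \<subseteq> V" using u(1) sub by (intro vec.span_minimal) auto
    show "V \<subseteq> vec.span (u ` M)"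
      using u dimV by (intro vec.card_ge_dim_independent) (auto simp: card_image)
  qed
  \<comment> \<open>The pairs i, j range over all integers, but only finitely many residue sets
    arise.\<close>
  define \<Y> where "\<Y> = {residue CARD('n) ` {i..j} | i j. i \<le> j}"
  have \<Y>sub: "Y \<subseteq> {1..CARD('n)}" if "Y \<in> \<Y>" for Y
    using that residue_decomp(1)[OF card_ge_1[where 'n='n]] by (auto simp: \<Y>_def)
  hence fin\<Y>: "finite \<Y>" using finite_subset[of \<Y> "Pow {1..CARD('n)}"] by blast
  have "\<exists>w. (\<forall>S\<in>M. w S \<in> coord_span e S) \<and> (\<forall>Y\<in>\<Y>. generic_rank M Y \<le> vec.dim (coord_proj e Y ` w ` M))"
    using cyclic_matching[OF M le card_ge_1] \<Y>sub
    by (intro generic_adapted_family[OF e fin fin\<Y>]) (auto simp: \<Y>_def)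
  then obtain w where w: "\<And>S. S \<in> M \<Longrightarrow> w S \<in> coord_span e S"
    "\<And>Y. Y \<in> \<Y> \<Longrightarrow> generic_rank M Y \<le> vec.dim (coord_proj e Y ` w ` M)" by blast
  \<comment> \<open>Chosen so that 1 + t f moves \<open>u S\<close> along the segment to
    \<open>w S\<close>: \<open>V\<close> is the subspace at t = 0.\<close>
  obtain f where f: "Vector_Spaces.linear (*s) (*s) f" "\<And>S. S \<in> M \<Longrightarrow> f (u S) = w S - u S"
    using vec.linear_independent_extend[OF u(3), of "\<lambda>x. w (inv_into M u x) - x"] u(2) by auto
  define g where "g t = (\<lambda>x. x + t *s f x)" for t
  have lin: "Vector_Spaces.linear (*s) (*s) (g t)" for t
    unfolding g_def using f(1) by (intro vec.linear_compose_add vec.linear_ident vec.linear_compose_scale_right)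
  have gu: "g t (u S) = (1 - t) *s u S + t *s w S" if "S \<in> M" for t S
    by (simp add: g_def f(2)[OF that] vec.scale_left_diff_distrib vec.scale_right_diff_distrib)
  have gV: "g t ` V = vec.span ((\<lambda>S. g t (u S)) ` M)" for t
    unfolding spanV[symmetric] vec.linear_span_image[OF lin, symmetric] image_image ..
  let ?bad = "\<lambda>Y. {t. vec.dim (coord_proj e Y ` (\<lambda>S. g t (u S)) ` M) < vec.dim (coord_proj e Y ` w ` M)}"
  have badY: "finite (?bad Y)" for Y
  proof -
    have "coord_proj e Y ` (\<lambda>S. g t (u S)) ` M
      = (\<lambda>S. (1 - t) *s coord_proj e Y (u S) + t *s coord_proj e Y (w S)) ` M" for t
      by (auto simp: gu image_image vec.linear_add[OF linear_coord_proj[OF e]]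
        vec.linear_scale[OF linear_coord_proj[OF e]])
    thus ?thesis
      using finite_dim_segment_drop[OF fin, of "\<lambda>S. coord_proj e Y (u S)" "\<lambda>S. coord_proj e Y (w S)"]
      by (auto simp: image_image elim!: rev_finite_subset)
  qed
  \<comment> \<open>The bad parameters: \<open>g t\<close> is not injective, or some projection rank
    falls below the one reached by \<open>w\<close>.\<close>
  define B where "B = {t. \<not> inj (g t)} \<union> (\<Union>Y\<in>\<Y>. ?bad Y)"
  have "finite {t. \<not> inj (g t)}"
    using finite_not_inj_id_plus_scaled[OF f(1)] by (simp add: g_def)
  hence finB: "finite B" using fin\<Y> badY by (simp add: B_def)
  have inj: "inj (g t)" if "t \<notin> B" for t using that by (simp add: B_def)
  have inZ: "g t ` V \<in> Z" if t: "t \<notin> B" for t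
  proof -
    have "vec.dim (g t ` V) = card M"
      using vec.dim_image_eq[OF lin inj_on_subset[OF inj[OF t] subset_UNIV]] dimV by simp
    hence "g t ` V \<in> Gr (card M)"
      using vec.linear_subspace_image[OF lin sub] by (simp add: Gr_def)
    moreover have "vec.dim (coord_proj e Y ` g t ` V) = generic_rank M Y" if Y: "Y \<in> \<Y>" for Y
    \<comment> \<open>The upper bound holds for every adapted family; the lower one because t is not
      bad.\<close>
    proof (rule antisym)
      have "g t (u S) \<in> coord_span e S" if "S \<in> M" for S
        unfolding gu[OF that] using u(1)[OF that] w(1)[OF that]
        unfolding coord_span_def by (auto intro: vec.span_add vec.span_scale)
      thus "vec.dim (coord_proj e Y ` g t ` V) \<le> generic_rank M Y"
        unfolding gV using fin \<Y>sub[OF Y] rank_set_mem_iff(3)[OF M le card_ge_1]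
        by (intro dim_coord_proj_span_le[OF e])
      have "generic_rank M Y \<le> vec.dim (coord_proj e Y ` (\<lambda>S. g t (u S)) ` M)"
        using t Y w(2)[OF Y] by (auto simp: B_def not_less)
      also have "\<dots> \<le> vec.dim (coord_proj e Y ` g t ` V)"
        unfolding gV by (intro vec.dim_subset image_mono vec.span_superset)
      finally show "generic_rank M Y \<le> vec.dim (coord_proj e Y ` g t ` V)" .
    qed
    hence "\<forall>i j. i \<le> j \<longrightarrow> vec.dim (coord_proj e (residue CARD('n) ` {i..j}) ` g t ` V)
        = generic_rank M (residue CARD('n) ` {i..j})" by (auto simp: \<Y>_def)
    ultimately show ?thesis using Z(2) by (auto simp: positroid_stratum_def)
  qed
  obtain P where P: "\<And>F. F \<in> P \<Longrightarrow> \<exists>d. hom_poly {I. I \<subseteq> {1..CARD('n)} \<and> card I = card M} d F"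
    "Z = {V \<in> Gr (card M). \<forall>v. basis_of (card M) v V \<longrightarrow> (\<forall>F\<in>P. F (plucker e (card M) v) = 0)}"
    using Z(1) unfolding zariski_closed_def by blast
  have "F (plucker e (card M) v) = 0" if v: "basis_of (card M) v V" and F: "F \<in> P" for v F
  proof -
    define h where "h t = F (plucker e (card M) (\<lambda>r. v r + t *s f (v r)))" for t
    have "h t = 0" if t: "t \<notin> B" for t
    proof -
      \<comment> \<open>Membership of the moved subspace in \<open>Z\<close> is tested on the moved
        basis, which makes \<open>h t\<close> vanish.\<close>
      have "basis_of (card M) (\<lambda>r. g t (v r)) (g t ` V)"
      proof -
        have "inj_on (\<lambda>r. g t (v r)) {..<card M}"
          using v inj[OF t] by (auto simp: basis_of_def inj_on_def)
        moreover have "vec.independent (g t ` v ` {..<card M})"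
          using v by (intro vec.linear_independent_injective_image[OF lin] inj_on_subset[OF inj[OF t]])
            (auto simp: basis_of_def)
        moreover have "vec.span (g t ` v ` {..<card M}) = g t ` V"
          using v by (simp add: vec.linear_span_image[OF lin] basis_of_def)
        ultimately show ?thesis by (simp add: basis_of_def image_image)
      qed
      thus ?thesis using inZ[OF t] F unfolding P(2) h_def g_def by blast
    qed
    hence "{t. h t \<noteq> 0} \<subseteq> B" by blast
    hence h_fin: "finite {t. h t \<noteq> 0}" using finB by (rule finite_subset)
    obtain d where d: "hom_poly {I. I \<subseteq> {1..CARD('n)} \<and> card I = card M} d F" using P(1)[OF F] by blast
    have h_cont: "continuous_on UNIV h"
      unfolding h_def by (rule hom_poly_continuous[OF d]) (rule continuous_plucker_segment[OF e])
    \<comment> \<open>The parameter 0 may be bad, so the value there comes from continuity; at 0 the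
      moved basis is \<open>v\<close> itself.\<close>
    have "h 0 = 0" by (rule continuous_zero_if_cofinitely_zero[OF h_cont h_fin])
    thus ?thesis by (simp add: h_def)
  qed
  thus "V \<in> Z" using VGr unfolding P(2) by blast
qed

text \<open>A closed set contains one stratum if and only if it contains the other, so both closures
  intersect the same family.\<close>

lemma rank_variety_eq_positroid_variety:
  "rank_variety e (card M) M = positroid_variety e (card M) (rank_set_perm CARD('n) M)"
proof -
  have "{Z. zariski_closed e (card M) Z \<and> rank_stratum \<subseteq> Z} = {Z. zariski_closed e (card M) Z \<and> positroid_stratum \<subseteq> Z}"
    using rank_stratum_subset_closed positroid_stratum_subset_rank_stratum by blast
  thus ?thesis
    unfolding positroid_variety_eq by (simp add: rank_variety_def zariski_closure_def rank_stratum_def)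
qed

end

theorem theorem3p12:
  fixes e :: "nat \<Rightarrow> complex^'n" and a b :: "nat \<Rightarrow> nat" and k n :: nat and M :: "nat set set"
  assumes "n = CARD('n)" and "coord_basis e"
    and "rank_set M" and "M = (\<lambda>i. {a i..b i}) ` {1..k}"
    and "strict_mono_on {1..k} b" and "\<forall>i\<in>{1..k}. b i \<le> n"
  shows "rank_variety e k M = positroid_variety e k (rank_set_perm n M)"
proof -
  \<comment> \<open>Members of a rank set are nonempty intervals, so \<open>{a i..b i}\<close>
    determines its ends.\<close>
  have ab: "a i \<le> b i" if "i \<in> {1..k}" for i
  proof -
    have "{a i..b i} \<in> M" using that assms(4) by blast
    then obtain c d where "c \<le> d" "{a i..b i} = {c..d}" using assms(3) unfolding rank_set_def by blast
    thus ?thesis by (metis Icc_eq_Icc)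
  qed
  have Max: "Max {a i..b i} = b i" if "i \<in> {1..k}" for i
    using ab[OF that] by (intro Max_eqI) auto
  \<comment> \<open>Increasing right ends make the listed intervals distinct, so \<open>k\<close> is
    the size of \<open>M\<close>.\<close>
  have "inj_on (\<lambda>i. {a i..b i}) {1..k}"
  proof (rule inj_onI)
    fix i j assume "i \<in> {1..k}" "j \<in> {1..k}" "{a i..b i} = {a j..b j}"
    moreover from this have "b i = b j" using Max by metis
    ultimately show "i = j" using strict_mono_on_imp_inj_on[OF assms(5)] by (meson inj_onD)
  qed
  hence "card M = card {1..k}" unfolding assms(4) by (rule card_image)
  hence k: "k = card M" by simp
  have "\<forall>S\<in>M. Max S \<le> CARD('n)" using Max assms(1,4,6) by auto
  thus ?thesis
    unfolding k assms(1) by (rule rank_variety_eq_positroid_variety[OF assms(2,3)])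
qed

end
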